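(* Let $k$ be a field and $(\mathscr{P},\theta)$ a finite poset with an involution. Let $\underline{P}=\bigoplus_{z\in\theta}P(z)\oplus P(0)$ in $\mathrm{Rep}(\mathscr{P},\theta)$, let $A=\mathrm{End}_{\mathrm{Rep}(\mathscr{P},\theta)}(\underline{P})$, and let $e_0\in A$ be the idempotent given by the projection onto the summand $P(0)$ followed by its inclusion into $\underline{P}$. Then $A$ is a right peak algebra, and the only simple projective right $A$-module up to isomorphism is $e_0A$.
   Context: Posets with an involution. A poset with an involution $(\mathscr{P},\theta)$ is a partially ordered set $\mathscr{P}$ with an equivalence relation all of whose classes have at most two elements; $\theta$ is the set of equivalence classes. Representations. For a $k$-vector space $V_0$ and $z\in\theta$, $V_0^z$ is the space of all functions $z\to V_0$. For $x\in z$, $i_x:V_0\to V_0^z$ is given by $i_x(v)(x)=v$, $i_x(v)(y)=0$ for $y\ne x$, and $\pi_x:V_0^z\to V_0$ is $\pi_x(h)=h(x)$. For a subspace $V_z\subset V_0^z$ and $x\in z$ put $V_x^-=i_x^{-1}(V_z)$, $V_x^+=\pi_x(V_z)$. A representation $V=(V_0,V_z)_{z\in\theta}$ consists of a finite-dimensional $k$-space $V_0$ and subspaces $V_z\subset V_0^z$ ($z\in\theta$) with $V_y^+\subset V_x^-$ whenever $y<x$ in $\mathscr{P}$. A morphism $V\to W$ is a linear map $\varphi:V_0\to W_0$ with $\varphi^z(V_z)\subset W_z$ for all $z$, where $\varphi^z(h)=\varphi h$. The category is $\mathrm{Rep}(\mathscr{P},\theta)$; direct sums are $V\oplus W=(V_0\oplus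 W_0,V_z\oplus W_z)_z$. A two-element class is written $z=(a,b)$ (with $a<b$ if comparable), and $(u,v)\in V_0^z$ is the function $a\mapsto u$, $b\mapsto v$. The representations $P(w)$ and $P(0)$. Let $\lambda(c,d)=1$ if $c<d$ and $0$ otherwise. For a two-element class $w=(a,b)$, $P(w)_0=k\langle e_1,e_2\rangle$ is two-dimensional; $P(w)_w=\langle(e_1,e_2)\rangle$ if $a,b$ are incomparable and $P(w)_w=\langle(0,e_1),(e_1,e_2)\rangle$ if $a<b$; for $z\ne w$, $P(w)_z$ is spanned by $i_x(\lambda(a,x)e_1)$, $i_x(\lambda(b,x)e_2)$ with $x\in z$. For $w=\{a\}$, $P(w)_0=k\langle e\rangle$, $P(w)_w=\langle e\rangle$, and for $z\ne w$, $P(w)_z$ is spanned by $i_x(\lambda(a,x)e)$ with $x\in z$. $P(0)=S$ is the representation with $S_0=k$ and $S_z=0$ for all $z\in\theta$. An algebra $B$ is a right peak algebra if $\mathrm{soc}(B_B)$ is a direct sum of copies of a simple projective module. *)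

theory Defs
  imports HOL.Vector_Spaces "HOL-Algebra.Ring" "HOL-Library.Function_Algebras" "HOL-Library.Product_Plus"
begin

section \<open>Posets with an involution\<close>

definition poset_with_involution :: "'p set \<Rightarrow> ('p \<times> 'p) set \<Rightarrow> 'p set set \<Rightarrow> bool" where
  "poset_with_involution P r \<theta> \<longleftrightarrow>
     partial_order_on P r \<and> (\<exists>E. equiv P E \<and> \<theta> = P // E) \<and> (\<forall>z\<in>\<theta>. finite z \<and> card z \<le> 2)"

definition strictly_below :: "('p \<times> 'p) set \<Rightarrow> 'p \<Rightarrow> 'p \<Rightarrow> bool" where
  "strictly_below r c d \<longleftrightarrow> (c, d) \<in> r \<and> c \<noteq> d"


section \<open>Representations\<close>

text \<open>A vector space is a subspace of an ambient space \<open>'v\<close> whose scalar multiplication is passed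
  as an argument, in the form expected by \<^locale>\<open>vector_space\<close>.\<close>

definition fun_scale :: "('k \<Rightarrow> 'v \<Rightarrow> 'v) \<Rightarrow> 'k \<Rightarrow> ('i \<Rightarrow> 'v) \<Rightarrow> ('i \<Rightarrow> 'v)" where
  "fun_scale s c f = (\<lambda>i. s c (f i))"

definition prod_scale :: "('k \<Rightarrow> 'v \<Rightarrow> 'v) \<Rightarrow> ('k \<Rightarrow> 'w \<Rightarrow> 'w) \<Rightarrow> 'k \<Rightarrow> 'v \<times> 'w \<Rightarrow> 'v \<times> 'w" where
  "prod_scale s t c x = (s c (fst x), t c (snd x))"

text \<open>\<open>V\<^sub>0\<close> is \<open>rep_space V\<close> and \<open>V\<^sub>z\<close> is \<open>rep_at V z\<close>; only the values of \<open>rep_at V\<close> on \<open>\<theta>\<close>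
  matter.\<close>

record ('p, 'v) rep =
  rep_space :: "'v set"
  rep_at :: "'p set \<Rightarrow> ('p \<Rightarrow> 'v) set"

text \<open>A function \<open>z \<rightarrow> V\<^sub>0\<close> is encoded as a function on \<open>'p\<close> that vanishes outside \<open>z\<close>, so that
  \<open>V\<^sub>0\<^sup>z\<close> is a subspace of the ambient space \<open>'p \<Rightarrow> 'v\<close>.\<close>

definition fun_space :: "'p set \<Rightarrow> 'v set \<Rightarrow> ('p \<Rightarrow> 'v::zero) set" where
  "fun_space z V0 = {h. (\<forall>x\<in>z. h x \<in> V0) \<and> (\<forall>x. x \<notin> z \<longrightarrow> h x = 0)}"

definition inj_at :: "'p \<Rightarrow> 'v \<Rightarrow> 'p \<Rightarrow> 'v::zero" where
  "inj_at x v = (\<lambda>y. if y = x then v else 0)"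

definition proj_at :: "'p \<Rightarrow> ('p \<Rightarrow> 'v) \<Rightarrow> 'v" where
  "proj_at x h = h x"

definition V_minus :: "('p, 'v::zero) rep \<Rightarrow> 'p set \<Rightarrow> 'p \<Rightarrow> 'v set" where
  "V_minus V z x = {v \<in> rep_space V. inj_at x v \<in> rep_at V z}"

definition V_plus :: "('p, 'v) rep \<Rightarrow> 'p set \<Rightarrow> 'p \<Rightarrow> 'v set" where
  "V_plus V z x = proj_at x ` rep_at V z"

definition representation ::
  "('k::field \<Rightarrow> 'v::ab_group_add \<Rightarrow> 'v) \<Rightarrow> ('p \<times> 'p) set \<Rightarrow> 'p set set \<Rightarrow> ('p, 'v) rep \<Rightarrow> bool" where
  "representation s r \<theta> V \<longleftrightarrow>
     vector_space s \<and> module.subspace s (rep_space V) \<and>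
     (\<exists>B. finite B \<and> rep_space V = module.span s B) \<and>
     (\<forall>z\<in>\<theta>. module.subspace (fun_scale s) (rep_at V z) \<and> rep_at V z \<subseteq> fun_space z (rep_space V)) \<and>
     (\<forall>z\<in>\<theta>. \<forall>z'\<in>\<theta>. \<forall>x\<in>z. \<forall>y\<in>z'. strictly_below r y x \<longrightarrow> V_plus V z' y \<subseteq> V_minus V z x)"

definition fun_map :: "'p set \<Rightarrow> ('v \<Rightarrow> 'w) \<Rightarrow> ('p \<Rightarrow> 'v) \<Rightarrow> 'p \<Rightarrow> 'w::zero" where
  "fun_map z \<phi> h = (\<lambda>x. if x \<in> z then \<phi> (h x) else 0)"

definition rep_hom ::
  "('k \<Rightarrow> 'v::ab_group_add \<Rightarrow> 'v) \<Rightarrow> ('k \<Rightarrow> 'w::ab_group_add \<Rightarrow> 'w) \<Rightarrow> 'p set set \<Rightarrow>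
   ('p, 'v) rep \<Rightarrow> ('p, 'w) rep \<Rightarrow> ('v \<Rightarrow> 'w) set" where
  "rep_hom s t \<theta> V W =
     {\<phi> \<in> rep_space V \<rightarrow>\<^sub>E rep_space W.
        (\<forall>u\<in>rep_space V. \<forall>v\<in>rep_space V. \<phi> (u + v) = \<phi> u + \<phi> v) \<and>
        (\<forall>c. \<forall>v\<in>rep_space V. \<phi> (s c v) = t c (\<phi> v)) \<and>
        (\<forall>z\<in>\<theta>. fun_map z \<phi> ` rep_at V z \<subseteq> rep_at W z)}"

definition rep_End ::
  "('k \<Rightarrow> 'v::ab_group_add \<Rightarrow> 'v) \<Rightarrow> 'p set set \<Rightarrow> ('p, 'v) rep \<Rightarrow> ('v \<Rightarrow> 'v) ring" where
  "rep_End s \<theta> V =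
     \<lparr>carrier = rep_hom s s \<theta> V V,
      mult = (\<lambda>f g. compose (rep_space V) f g),
      one = (\<lambda>v\<in>rep_space V. v),
      zero = (\<lambda>v\<in>rep_space V. 0),
      add = (\<lambda>f g. \<lambda>v\<in>rep_space V. f v + g v)\<rparr>"

definition rep_End_scale ::
  "('k \<Rightarrow> 'v \<Rightarrow> 'v) \<Rightarrow> ('p, 'v) rep \<Rightarrow> 'k \<Rightarrow> ('v \<Rightarrow> 'v) \<Rightarrow> 'v \<Rightarrow> 'v" where
  "rep_End_scale s V c f = (\<lambda>v\<in>rep_space V. s c (f v))"

text \<open>The direct sum of a finite family.\<close>

definition rep_Sum :: "'i set \<Rightarrow> ('i \<Rightarrow> ('p, 'v::zero) rep) \<Rightarrow> ('p, 'i \<Rightarrow> 'v) rep" where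
  "rep_Sum I V =
     \<lparr>rep_space = {f. (\<forall>i\<in>I. f i \<in> rep_space (V i)) \<and> (\<forall>i. i \<notin> I \<longrightarrow> f i = 0)},
      rep_at = (\<lambda>z. {h. (\<forall>i\<in>I. (\<lambda>x. h x i) \<in> rep_at (V i) z) \<and> (\<forall>i x. i \<notin> I \<longrightarrow> h x i = 0)})\<rparr>"

definition rep_plus :: "('p, 'v) rep \<Rightarrow> ('p, 'w) rep \<Rightarrow> ('p, 'v \<times> 'w) rep" where
  "rep_plus V W =
     \<lparr>rep_space = rep_space V \<times> rep_space W,
      rep_at = (\<lambda>z. {\<lambda>x. (g x, h x) | g h. g \<in> rep_at V z \<and> h \<in> rep_at W z})\<rparr>"


section \<open>The representations \<open>P(w)\<close> and \<open>P(0)\<close>\<close>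

definition lam :: "('p \<times> 'p) set \<Rightarrow> 'p \<Rightarrow> 'p \<Rightarrow> 'k::field" where
  "lam r c d = (if strictly_below r c d then 1 else 0)"

definition basis_vec :: "'p \<Rightarrow> 'p \<Rightarrow> 'k::field" where
  "basis_vec a = (\<lambda>y. if y = a then 1 else 0)"

text \<open>The basis vectors are labelled by the elements of \<open>w\<close>: for \<open>w = (a,b)\<close>, \<open>e\<^sub>1\<close> is
  \<open>basis_vec a\<close> and \<open>e\<^sub>2\<close> is \<open>basis_vec b\<close>; for \<open>w = {a}\<close>, \<open>e\<close> is \<open>basis_vec a\<close>.  The first
  generator of \<open>P(w)\<^sub>w\<close> below is \<open>(e\<^sub>1,e\<^sub>2)\<close>, respectively \<open>e\<close>.  A generator of the second kind exists
  only if \<open>w = (a,b)\<close> with \<open>a < b\<close>, and then it is \<open>(0,e\<^sub>1)\<close>.\<close>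

definition rep_P :: "('p \<times> 'p) set \<Rightarrow> 'p set \<Rightarrow> ('p, 'p \<Rightarrow> 'k::field) rep" where
  "rep_P r w =
     \<lparr>rep_space = module.span (fun_scale (*)) (basis_vec ` w),
      rep_at = (\<lambda>z.
        if z = w then
          module.span (fun_scale (fun_scale (*)))
            ({\<lambda>x. if x \<in> w then basis_vec x else 0} \<union>
             {inj_at b (basis_vec a) | a b. a \<in> w \<and> b \<in> w \<and> strictly_below r a b})
        else
          module.span (fun_scale (fun_scale (*)))
            {inj_at x (fun_scale (*) (lam r a x) (basis_vec a)) | a x. a \<in> w \<and> x \<in> z})\<rparr>"

definition rep_P0 :: "('p, 'k::field) rep" where
  "rep_P0 = \<lparr>rep_space = UNIV, rep_at = (\<lambda>z. {0})\<rparr>"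

type_synonym ('p, 'k) big_space = "('p set \<Rightarrow> 'p \<Rightarrow> 'k) \<times> 'k"

definition big_scale :: "'k::field \<Rightarrow> ('p, 'k) big_space \<Rightarrow> ('p, 'k) big_space" where
  "big_scale = prod_scale (fun_scale (fun_scale (*))) (*)"

definition big_P :: "('p \<times> 'p) set \<Rightarrow> 'p set set \<Rightarrow> ('p, ('p, 'k::field) big_space) rep" where
  "big_P r \<theta> = rep_plus (rep_Sum \<theta> (rep_P r)) rep_P0"

definition big_e0 ::
  "('p \<times> 'p) set \<Rightarrow> 'p set set \<Rightarrow> ('p, 'k::field) big_space \<Rightarrow> ('p, 'k) big_space" where
  "big_e0 r \<theta> = (\<lambda>v\<in>rep_space (big_P r \<theta>). (0, snd v))"


subsection \<open>\<open>big_P\<close> is a representation and \<open>big_e0\<close> an idempotent endomorphism\<close>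

lemma vector_space_fun_scale:
  assumes "vector_space s" shows "vector_space (fun_scale s)"
proof -
  interpret vector_space s by fact
  show ?thesis
    by unfold_locales
      (auto simp: fun_scale_def fun_eq_iff scale_right_distrib scale_left_distrib)
qed

lemma vector_space_prod_scale:
  assumes "vector_space s" "vector_space t" shows "vector_space (prod_scale s t)"
proof -
  interpret s: vector_space s by fact
  interpret t: vector_space t by fact
  show ?thesis
    by unfold_locales
      (auto simp: prod_scale_def plus_prod_def s.scale_right_distrib s.scale_left_distrib
         t.scale_right_distrib t.scale_left_distrib)
qed

lemma vector_space_times: "vector_space ((*) :: 'k::field \<Rightarrow> 'k \<Rightarrow> 'k)"
  by unfold_locales (auto simp: algebra_simps)

lemma vector_space_imp_module: "vector_space s \<Longrightarrow> module s"
  by (simp add: vector_space_def module_def)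

lemma vector_space_subspaceI:
  assumes "vector_space s" "0 \<in> S" "\<And>x y. x \<in> S \<Longrightarrow> y \<in> S \<Longrightarrow> x + y \<in> S"
    "\<And>c x. x \<in> S \<Longrightarrow> s c x \<in> S"
  shows "module.subspace s S"
  using module.subspaceI[OF vector_space_imp_module[OF assms(1)], of S] assms by blast

lemma vector_space_subspaceD:
  assumes "vector_space s" "module.subspace s S"
  shows "0 \<in> S" "\<And>x y. x \<in> S \<Longrightarrow> y \<in> S \<Longrightarrow> x + y \<in> S" "\<And>c x. x \<in> S \<Longrightarrow> s c x \<in> S"
proof -
  interpret vector_space s by fact
  show "0 \<in> S" "\<And>x y. x \<in> S \<Longrightarrow> y \<in> S \<Longrightarrow> x + y \<in> S" "\<And>c x. x \<in> S \<Longrightarrow> s c x \<in> S"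
    using assms(2) by (simp_all add: subspace_0 subspace_add subspace_scale)
qed

lemma representation_le:
  assumes "representation s r \<theta> V" "z \<in> \<theta>" "z' \<in> \<theta>" "x \<in> z" "y \<in> z'" "strictly_below r y x"
    "u \<in> V_plus V z' y"
  shows "u \<in> V_minus V z x"
  using assms unfolding representation_def by (elim conjE) (metis subsetD)

lemma representation_P0: "representation (*) r \<theta> (rep_P0 :: ('p, 'k::field) rep)"
proof -
  interpret k: vector_space "(*) :: 'k \<Rightarrow> 'k \<Rightarrow> 'k" by (rule vector_space_times)
  have 1: "module.subspace (fun_scale (*)) ({0} :: ('p \<Rightarrow> 'k) set)"
    by (rule vector_space_subspaceI) (auto intro!: vector_space_fun_scale vector_space_times simp: fun_scale_def)
  have 2: "k.span {1} = (UNIV :: 'k set)"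
    by (auto simp: k.span_singleton image_iff)
  have 3: "\<exists>B. finite B \<and> (UNIV :: 'k set) = k.span B"
    using 2 by (intro exI[of _ "{1}"]) auto
  have 4: "rep_at rep_P0 z = ({0} :: ('p \<Rightarrow> 'k) set)" "rep_space (rep_P0 :: ('p,'k) rep) = UNIV" for z
    by (simp_all add: rep_P0_def)
  have 5: "V_plus (rep_P0 :: ('p,'k) rep) z' y \<subseteq> V_minus (rep_P0 :: ('p,'k) rep) z x" for z z' x and y :: 'p
    unfolding V_plus_def V_minus_def by (auto simp: rep_P0_def proj_at_def inj_at_def fun_eq_iff)
  have 6: "{0} \<subseteq> fun_space z (UNIV :: 'k set)" for z :: "'p set"
    by (auto simp: fun_space_def)
  show ?thesis
    unfolding representation_def 4
    by (intro conjI ballI impI vector_space_times k.subspace_UNIV 3 1 5 6)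
qed


lemma representation_plus:
  fixes s :: "'k::field \<Rightarrow> 'v::ab_group_add \<Rightarrow> 'v" and t :: "'k \<Rightarrow> 'w::ab_group_add \<Rightarrow> 'w"
    and V :: "('p, 'v) rep" and W :: "('p, 'w) rep"
  assumes V: "representation s r \<theta> V" and W: "representation t r \<theta> W"
  shows "representation (prod_scale s t) r \<theta> (rep_plus V W)"
proof -
  have vs: "vector_space s" "vector_space t"
    using V W by (auto simp: representation_def)
  interpret s: vector_space s by (rule vs)
  interpret t: vector_space t by (rule vs)
  interpret p: vector_space "prod_scale s t" by (intro vector_space_prod_scale vs)
  have vf: "vector_space (fun_scale s :: 'k \<Rightarrow> ('p \<Rightarrow> 'v) \<Rightarrow> 'p \<Rightarrow> 'v)"
      "vector_space (fun_scale t :: 'k \<Rightarrow> ('p \<Rightarrow> 'w) \<Rightarrow> 'p \<Rightarrow> 'w)"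
      "vector_space (fun_scale (prod_scale s t) :: 'k \<Rightarrow> ('p \<Rightarrow> 'v \<times> 'w) \<Rightarrow> 'p \<Rightarrow> 'v \<times> 'w)"
    by (intro vector_space_fun_scale vs p.vector_space_axioms)+
  obtain B C where B: "finite B" "rep_space V = s.span B" and C: "finite C" "rep_space W = t.span C"
    using V W by (auto simp: representation_def)
  have at: "module.subspace (fun_scale s) (rep_at V z)" "module.subspace (fun_scale t) (rep_at W z)"
    "rep_at V z \<subseteq> fun_space z (rep_space V)" "rep_at W z \<subseteq> fun_space z (rep_space W)"
    if "z \<in> \<theta>" for z using V W that by (auto simp: representation_def)
  let ?D = "(\<lambda>v. (v, 0)) ` B \<union> (\<lambda>v. (0, v)) ` C"
  have "p.span ?D = rep_space V \<times> rep_space W"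
  proof (rule p.span_unique)
    show "?D \<subseteq> rep_space V \<times> rep_space W"
      by (auto simp: B C s.span_base t.span_base s.span_zero t.span_zero)
    show "p.subspace (rep_space V \<times> rep_space W)"
      by (rule p.subspaceI)
        (auto simp: B C prod_scale_def zero_prod_def s.span_zero t.span_zero s.span_add t.span_add
          s.span_scale t.span_scale)
  next
    fix T assume T: "?D \<subseteq> T" "p.subspace T"
    have 1: "(v, 0) \<in> T" if "v \<in> s.span B" for v
      using that
    proof (induction rule: s.span_induct_alt)
      case base
      then show ?case using p.subspace_0[OF T(2)] by (simp add: zero_prod_def)
    next
      case (step c x y)
      have "prod_scale s t c (x, 0) + (y, 0) \<in> T"
        using step T by (intro p.subspace_add p.subspace_scale) auto
      then show ?case by (simp add: prod_scale_def)
    qed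
    have 2: "(0, v) \<in> T" if "v \<in> t.span C" for v
      using that
    proof (induction rule: t.span_induct_alt)
      case base
      then show ?case using p.subspace_0[OF T(2)] by (simp add: zero_prod_def)
    next
      case (step c x y)
      have "prod_scale s t c (0, x) + (0, y) \<in> T"
        using step T by (intro p.subspace_add p.subspace_scale) auto
      then show ?case by (simp add: prod_scale_def)
    qed
    show "rep_space V \<times> rep_space W \<subseteq> T"
    proof clarify
      fix v w assume "v \<in> rep_space V" "w \<in> rep_space W"
      then have "(v, 0) + (0, w) \<in> T"
        using 1 2 T B C by (intro p.subspace_add) auto
      then show "(v, w) \<in> T" by simp
    qed
  qed
  then have fin: "\<exists>D. finite D \<and> rep_space (rep_plus V W) = p.span D"
    using B C by (intro exI[of _ ?D]) (auto simp: rep_plus_def)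
  then have sub: "p.subspace (rep_space (rep_plus V W))" by auto
  have in_at: "h \<in> rep_at (rep_plus V W) z \<longleftrightarrow>
      (\<lambda>x. fst (h x)) \<in> rep_at V z \<and> (\<lambda>x. snd (h x)) \<in> rep_at W z" for h z
    by (force simp: rep_plus_def)
  have 1: "module.subspace (fun_scale (prod_scale s t)) (rep_at (rep_plus V W) z)" if "z \<in> \<theta>" for z
  proof (rule vector_space_subspaceI[OF vf(3)])
    show "0 \<in> rep_at (rep_plus V W) z"
      using vector_space_subspaceD(1)[OF vf(1) at(1)] vector_space_subspaceD(1)[OF vf(2) at(2)] that
      by (simp add: in_at zero_fun_def)
  next
    fix g h assume "g \<in> rep_at (rep_plus V W) z" "h \<in> rep_at (rep_plus V W) z"
    then show "g + h \<in> rep_at (rep_plus V W) z"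
      using vector_space_subspaceD(2)[OF vf(1) at(1)[OF that], of "\<lambda>x. fst (g x)" "\<lambda>x. fst (h x)"]
        vector_space_subspaceD(2)[OF vf(2) at(2)[OF that], of "\<lambda>x. snd (g x)" "\<lambda>x. snd (h x)"]
      by (simp add: in_at plus_fun_def)
  next
    fix c h assume "h \<in> rep_at (rep_plus V W) z"
    then show "fun_scale (prod_scale s t) c h \<in> rep_at (rep_plus V W) z"
      using vector_space_subspaceD(3)[OF vf(1) at(1)[OF that], of "\<lambda>x. fst (h x)" c]
        vector_space_subspaceD(3)[OF vf(2) at(2)[OF that], of "\<lambda>x. snd (h x)" c]
      by (simp add: in_at fun_scale_def prod_scale_def)
  qed
  have 2: "rep_at (rep_plus V W) z \<subseteq> fun_space z (rep_space (rep_plus V W))" if "z \<in> \<theta>" for z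
  proof
    fix h assume "h \<in> rep_at (rep_plus V W) z"
    then have "(\<lambda>x. fst (h x)) \<in> fun_space z (rep_space V)" "(\<lambda>x. snd (h x)) \<in> fun_space z (rep_space W)"
      using at(3,4)[OF that] by (auto simp: in_at)
    then show "h \<in> fun_space z (rep_space (rep_plus V W))"
      by (auto simp: fun_space_def rep_plus_def mem_Times_iff prod_eq_iff)
  qed
  have 3: "V_plus (rep_plus V W) z' y \<subseteq> V_minus (rep_plus V W) z x"
    if "z \<in> \<theta>" "z' \<in> \<theta>" "x \<in> z" "y \<in> z'" "strictly_below r y x" for z z' x y
  proof
    fix u assume "u \<in> V_plus (rep_plus V W) z' y"
    then obtain h where h: "u = h y" "h \<in> rep_at (rep_plus V W) z'"
      by (auto simp: V_plus_def proj_at_def)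
    have "fst u \<in> V_plus V z' y" "snd u \<in> V_plus W z' y"
      using h by (auto simp: V_plus_def proj_at_def in_at image_iff)
    then have u: "fst u \<in> V_minus V z x" "snd u \<in> V_minus W z x"
      using representation_le[OF V that] representation_le[OF W that] by auto
    have "(\<lambda>y. fst (inj_at x u y)) = inj_at x (fst u)" "(\<lambda>y. snd (inj_at x u y)) = inj_at x (snd u)"
      by (auto simp: inj_at_def)
    then show "u \<in> V_minus (rep_plus V W) z x"
      using u unfolding V_minus_def mem_Collect_eq in_at
      by (simp add: rep_plus_def mem_Times_iff)
  qed
  show ?thesis
    unfolding representation_def
    by (intro conjI ballI impI p.vector_space_axioms sub fin 1 2 3)
qed

lemma representation_Sum:
  fixes s :: "'k::field \<Rightarrow> 'v::ab_group_add \<Rightarrow> 'v" and V :: "'i \<Rightarrow> ('p, 'v) rep"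
  assumes I: "finite I" and V: "\<And>i. i \<in> I \<Longrightarrow> representation s r \<theta> (V i)" and vs: "vector_space s"
  shows "representation (fun_scale s) r \<theta> (rep_Sum I V)"
proof -
  interpret s: vector_space s by (rule vs)
  interpret f: vector_space "fun_scale s :: 'k \<Rightarrow> ('i \<Rightarrow> 'v) \<Rightarrow> 'i \<Rightarrow> 'v"
    by (intro vector_space_fun_scale vs)
  have vf: "vector_space (fun_scale s :: 'k \<Rightarrow> ('p \<Rightarrow> 'v) \<Rightarrow> 'p \<Rightarrow> 'v)"
    "vector_space (fun_scale (fun_scale s) :: 'k \<Rightarrow> ('p \<Rightarrow> 'i \<Rightarrow> 'v) \<Rightarrow> 'p \<Rightarrow> 'i \<Rightarrow> 'v)"
    by (intro vector_space_fun_scale vs)+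
  have "\<forall>i. \<exists>B. i \<in> I \<longrightarrow> finite B \<and> rep_space (V i) = s.span B"
    using V by (auto simp: representation_def)
  then obtain B where B: "\<And>i. i \<in> I \<Longrightarrow> finite (B i)" "\<And>i. i \<in> I \<Longrightarrow> rep_space (V i) = s.span (B i)"
    by metis
  have at: "module.subspace (fun_scale s) (rep_at (V i) z)" "rep_at (V i) z \<subseteq> fun_space z (rep_space (V i))"
    if "z \<in> \<theta>" "i \<in> I" for z i using V that by (auto simp: representation_def)
  let ?S = "rep_space (rep_Sum I V)"
  have in_S: "v \<in> ?S \<longleftrightarrow> (\<forall>i\<in>I. v i \<in> rep_space (V i)) \<and> (\<forall>i. i \<notin> I \<longrightarrow> v i = 0)" for v
    by (simp add: rep_Sum_def)
  let ?D = "\<Union>i\<in>I. inj_at i ` B i"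
  have sub: "f.subspace ?S"
    by (rule f.subspaceI)
      (auto simp: in_S fun_scale_def B s.span_zero s.span_add s.span_scale)
  have "f.span ?D = ?S"
  proof (rule f.span_unique)
    show "?D \<subseteq> ?S"
      by (auto simp: in_S inj_at_def B s.span_base s.span_zero)
  next
    fix T assume T: "?D \<subseteq> T" "f.subspace T"
    have 1: "inj_at i v \<in> T" if "v \<in> s.span (B i)" and i: "i \<in> I" for i v
      using that(1)
    proof (induction rule: s.span_induct_alt)
      case base
      have "inj_at i 0 = (0 :: 'i \<Rightarrow> 'v)" by (auto simp: inj_at_def)
      then show ?case using f.subspace_0[OF T(2)] by (simp only:)
    next
      case (step c x y)
      have "fun_scale s c (inj_at i x) + inj_at i y \<in> T"
        using step T i by (intro f.subspace_add f.subspace_scale) auto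
      moreover have "fun_scale s c (inj_at i x) + inj_at i y = inj_at i (s c x + y)"
        by (auto simp: inj_at_def fun_scale_def)
      ultimately show ?case by simp
    qed
    show "?S \<subseteq> T"
    proof
      fix v assume v: "v \<in> ?S"
      have "v = (\<Sum>i\<in>I. inj_at i (v i))"
      proof
        fix j
        have *: "(\<Sum>i\<in>K. inj_at i (v i)) j = (\<Sum>i\<in>K. inj_at i (v i) j)" if "finite K" for K
          using that by (induction K) auto
        have "(\<Sum>i\<in>I. inj_at i (v i)) j = (\<Sum>i\<in>I. if j = i then v i else 0)"
          unfolding *[OF I] by (simp add: inj_at_def)
        then show "v j = (\<Sum>i\<in>I. inj_at i (v i)) j"
          using v I by (auto simp: in_S)
      qed
      moreover have "(\<Sum>i\<in>I. inj_at i (v i)) \<in> T"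
        using v T 1 B by (intro f.subspace_sum) (auto simp: in_S)
      ultimately show "v \<in> T" by simp
    qed
  qed (rule sub)
  then have fin: "\<exists>D. finite D \<and> ?S = f.span D"
    using B I by (intro exI[of _ ?D]) auto
  have in_at: "h \<in> rep_at (rep_Sum I V) z \<longleftrightarrow>
      (\<forall>i\<in>I. (\<lambda>x. h x i) \<in> rep_at (V i) z) \<and> (\<forall>i x. i \<notin> I \<longrightarrow> h x i = 0)" for h z
    by (simp add: rep_Sum_def)
  have 1: "module.subspace (fun_scale (fun_scale s)) (rep_at (rep_Sum I V) z)" if "z \<in> \<theta>" for z
  proof (rule vector_space_subspaceI[OF vf(2)])
    show "0 \<in> rep_at (rep_Sum I V) z"
      using vector_space_subspaceD(1)[OF vf(1) at(1)] that by (simp add: in_at zero_fun_def)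
  next
    fix g h assume "g \<in> rep_at (rep_Sum I V) z" "h \<in> rep_at (rep_Sum I V) z"
    then show "g + h \<in> rep_at (rep_Sum I V) z"
      using vector_space_subspaceD(2)[OF vf(1) at(1)[OF that]] by (fastforce simp add: in_at plus_fun_def)
  next
    fix c h assume "h \<in> rep_at (rep_Sum I V) z"
    then show "fun_scale (fun_scale s) c h \<in> rep_at (rep_Sum I V) z"
      using vector_space_subspaceD(3)[OF vf(1) at(1)[OF that]] by (fastforce simp add: in_at fun_scale_def)
  qed
  have 2: "rep_at (rep_Sum I V) z \<subseteq> fun_space z ?S" if "z \<in> \<theta>" for z
  proof
    fix h assume h: "h \<in> rep_at (rep_Sum I V) z"
    then have "(\<lambda>x. h x i) \<in> fun_space z (rep_space (V i))" if "i \<in> I" for i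
      using at(2)[OF \<open>z \<in> \<theta>\<close> that] that by (auto simp: in_at)
    moreover have "h x i = 0" if "i \<notin> I" for x i using h that by (auto simp: in_at)
    ultimately show "h \<in> fun_space z ?S"
      unfolding fun_space_def in_S mem_Collect_eq fun_eq_iff zero_fun_apply by blast
  qed
  have 3: "V_plus (rep_Sum I V) z' y \<subseteq> V_minus (rep_Sum I V) z x"
    if "z \<in> \<theta>" "z' \<in> \<theta>" "x \<in> z" "y \<in> z'" "strictly_below r y x" for z z' x y
  proof
    fix u assume "u \<in> V_plus (rep_Sum I V) z' y"
    then obtain h where h: "u = h y" "h \<in> rep_at (rep_Sum I V) z'"
      by (auto simp: V_plus_def proj_at_def)
    have u: "u i \<in> V_minus (V i) z x" if "i \<in> I" for i
    proof -
      have "u i \<in> V_plus (V i) z' y"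
        using h that by (auto simp: V_plus_def proj_at_def in_at image_iff)
      then show ?thesis
        using representation_le[OF V[OF that] \<open>z \<in> \<theta>\<close> \<open>z' \<in> \<theta>\<close> \<open>x \<in> z\<close> \<open>y \<in> z'\<close>]
          \<open>strictly_below r y x\<close> by blast
    qed
    have *: "(\<lambda>y. inj_at x u y i) = inj_at x (u i)" for i
      by (auto simp: inj_at_def)
    have u0: "u i = 0" if "i \<notin> I" for i using h that by (auto simp: in_at)
    then have "inj_at x u y i = 0" if "i \<notin> I" for y i
      using that by (auto simp: inj_at_def)
    then show "u \<in> V_minus (rep_Sum I V) z x"
      using u u0 unfolding V_minus_def by (auto simp: in_at in_S *)
  qed
  show ?thesis
    unfolding representation_def
    by (intro conjI ballI impI f.vector_space_axioms sub fin 1 2 3)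
qed


lemma strictly_below_trans:
  assumes "partial_order_on P r" "strictly_below r a b" "strictly_below r b c"
  shows "strictly_below r a c"
  using assms unfolding strictly_below_def partial_order_on_def preorder_on_def
  by (metis antisymD transD)

lemma representation_P:
  fixes r :: "('p \<times> 'p) set"
  assumes r: "partial_order_on P r" and w: "finite w"
  shows "representation (fun_scale (*)) r \<theta> (rep_P r w :: ('p, 'p \<Rightarrow> 'k::field) rep)"
proof -
  let ?V = "rep_P r w :: ('p, 'p \<Rightarrow> 'k) rep"
  interpret v: vector_space "fun_scale (*) :: 'k \<Rightarrow> ('p \<Rightarrow> 'k) \<Rightarrow> 'p \<Rightarrow> 'k"
    by (intro vector_space_fun_scale vector_space_times)
  interpret f: vector_space "fun_scale (fun_scale (*)) :: 'k \<Rightarrow> ('p \<Rightarrow> 'p \<Rightarrow> 'k) \<Rightarrow> 'p \<Rightarrow> 'p \<Rightarrow> 'k"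
    by (intro vector_space_fun_scale vector_space_times)
  define G :: "'p set \<Rightarrow> ('p \<Rightarrow> 'p \<Rightarrow> 'k) set" where "G = (\<lambda>z.
    if z = w then {\<lambda>x. if x \<in> w then basis_vec x else 0} \<union>
             {inj_at b (basis_vec a) | a b. a \<in> w \<and> b \<in> w \<and> strictly_below r a b}
    else {inj_at x (fun_scale (*) (lam r a x) (basis_vec a)) | a x. a \<in> w \<and> x \<in> z})"
  have sp: "rep_space ?V = v.span (basis_vec ` w)" and at: "rep_at ?V z = f.span (G z)" for z
    by (auto simp: rep_P_def G_def)
  have fin: "\<exists>B. finite B \<and> rep_space ?V = v.span B"
    using w sp by blast
  have bv: "basis_vec a \<in> rep_space ?V" if "a \<in> w" for a
    using that by (auto simp: sp intro: v.span_base)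
  have sub0: "v.subspace (rep_space ?V)" by (simp add: sp)
  have 1: "f.subspace (rep_at ?V z)" for z by (simp add: at)
  have 2: "rep_at ?V z \<subseteq> fun_space z (rep_space ?V)" for z
    unfolding at
  proof (rule f.span_minimal)
    show "f.subspace (fun_space z (rep_space ?V))"
      by (rule f.subspaceI)
        (auto simp: fun_space_def fun_scale_def[of "fun_scale _"] zero_fun_def[symmetric]
          sp v.span_zero v.span_add v.span_scale)
    show "G z \<subseteq> fun_space z (rep_space ?V)"
      using v.subspace_0[OF sub0] v.subspace_scale[OF sub0]
      by (auto simp: G_def fun_space_def inj_at_def bv)
  qed
  have below: "basis_vec a \<in> V_minus ?V z x" if "a \<in> w" "x \<in> z" "strictly_below r a x" for a x z
  proof -
    have "(inj_at x (basis_vec a) :: 'p \<Rightarrow> 'p \<Rightarrow> 'k) \<in> G z"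
    proof (cases "z = w")
      case False
      have "(basis_vec a :: 'p \<Rightarrow> 'k) = fun_scale (*) (lam r a x) (basis_vec a)"
        using that by (simp add: lam_def)
      then show ?thesis using that False unfolding G_def by auto
    qed (use that in \<open>auto simp: G_def\<close>)
    then show ?thesis
      using that by (auto simp: V_minus_def bv at intro: f.span_base)
  qed
  have sub: "v.subspace (V_minus ?V z x)" for z x
  proof (rule v.subspaceI)
    have "inj_at x 0 = (0 :: 'p \<Rightarrow> 'p \<Rightarrow> 'k)" by (auto simp: inj_at_def)
    then show "0 \<in> V_minus ?V z x"
      using f.subspace_0[OF 1] v.subspace_0[OF sub0] by (simp add: V_minus_def)
  next
    fix u u' :: "'p \<Rightarrow> 'k" and c
    have 1: "inj_at x (u + u') = inj_at x u + inj_at x u'" by (auto simp: inj_at_def)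
    have 2: "inj_at x (fun_scale (*) c u) = fun_scale (fun_scale (*)) c (inj_at x u)"
      by (auto simp: inj_at_def fun_scale_def fun_eq_iff)
    show "u + u' \<in> V_minus ?V z x" if "u \<in> V_minus ?V z x" "u' \<in> V_minus ?V z x"
      using that f.subspace_add[OF f.subspace_span] v.subspace_add[OF sub0]
      by (auto simp: V_minus_def 1 at)
    show "fun_scale (*) c u \<in> V_minus ?V z x" if "u \<in> V_minus ?V z x"
      using that f.subspace_scale[OF f.subspace_span] v.subspace_scale[OF sub0]
      by (auto simp: V_minus_def 2 at)
  qed
  have 3: "V_plus ?V z' y \<subseteq> V_minus ?V z x"
    if "z \<in> \<theta>" "z' \<in> \<theta>" "x \<in> z" "y \<in> z'" "strictly_below r y x" for z z' x y
  proof -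
    have gen: "g y \<in> V_minus ?V z x" if "g \<in> G z'" for g
    proof (cases "z' = w")
      case True
      from that[unfolded G_def if_P[OF True]] show ?thesis
      proof
        assume "g \<in> {\<lambda>x. if x \<in> w then basis_vec x else 0}"
        then show ?thesis using below \<open>x \<in> z\<close> \<open>y \<in> z'\<close> \<open>strictly_below r y x\<close> True by auto
      next
        assume "g \<in> {inj_at b (basis_vec a) | a b. a \<in> w \<and> b \<in> w \<and> strictly_below r a b}"
        then show ?thesis
          using below \<open>x \<in> z\<close> strictly_below_trans[OF r _ \<open>strictly_below r y x\<close>] v.subspace_0[OF sub]
          by (auto simp: inj_at_def)
      qed
    next
      case False
      from that[unfolded G_def if_not_P[OF False]] obtain a x' where
        g: "g = inj_at x' (fun_scale (*) (lam r a x') (basis_vec a))" "a \<in> w" by blast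
      show ?thesis
      proof (cases "x' = y \<and> strictly_below r a y")
        case True
        have "basis_vec a \<in> V_minus ?V z x"
          using True below g \<open>x \<in> z\<close> strictly_below_trans[OF r _ \<open>strictly_below r y x\<close>] by blast
        then show ?thesis using v.subspace_scale[OF sub] True by (simp add: g inj_at_def)
      next
        case False
        then have "g y = 0" by (auto simp: g inj_at_def lam_def)
        then show ?thesis using v.subspace_0[OF sub] by simp
      qed
    qed
    have "f.span (G z') \<subseteq> {h. h y \<in> V_minus ?V z x}"
    proof (rule f.span_minimal)
      show "f.subspace {h. h y \<in> V_minus ?V z x}"
        by (rule f.subspaceI)
          (auto simp: fun_scale_def[of "fun_scale _"] v.subspace_0[OF sub]
            v.subspace_add[OF sub] v.subspace_scale[OF sub])
    qed (use gen in blast)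
    then show ?thesis by (auto simp: V_plus_def proj_at_def at)
  qed
  show ?thesis
    unfolding representation_def
    by (intro conjI ballI impI v.vector_space_axioms sub0 fin 1 2 3)
qed

lemma representation_big_P:
  assumes "finite P" "poset_with_involution P r \<theta>"
  shows "representation big_scale r \<theta> (big_P r \<theta>)"
proof -
  have "finite \<theta>"
    using assms by (auto simp: poset_with_involution_def equiv_def intro: finite_quotient)
  moreover have "representation (fun_scale (*)) r \<theta> (rep_P r z :: ('a, 'a \<Rightarrow> 'b) rep)" if "z \<in> \<theta>" for z
    using assms that by (auto simp: poset_with_involution_def intro: representation_P)
  ultimately show ?thesis
    unfolding big_scale_def big_P_def
    by (intro representation_plus representation_Sum representation_P0
        vector_space_fun_scale vector_space_times)
qed

lemma rep_at_big_P:
  "h \<in> rep_at (big_P r \<theta>) z \<longleftrightarrow>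
     (\<lambda>x. fst (h x)) \<in> rep_at (rep_Sum \<theta> (rep_P r)) z \<and> (\<forall>x. snd (h x) = 0)"
proof
  assume "(\<lambda>x. fst (h x)) \<in> rep_at (rep_Sum \<theta> (rep_P r)) z \<and> (\<forall>x. snd (h x) = 0)"
  moreover from this have "h = (\<lambda>x. (fst (h x), (0 :: 'a \<Rightarrow> 'b) x))"
    by (auto simp: fun_eq_iff prod_eq_iff)
  ultimately show "h \<in> rep_at (big_P r \<theta>) z"
    unfolding big_P_def rep_plus_def rep_P0_def by fastforce
qed (auto simp: big_P_def rep_plus_def rep_P0_def)

lemma big_e0_idempotent:
  fixes A :: "(('p, 'k::field) big_space \<Rightarrow> ('p, 'k) big_space) ring"
  assumes "finite P" "poset_with_involution P r \<theta>"
    and A: "A = rep_End big_scale \<theta> (big_P r \<theta>)"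
  shows "big_e0 r \<theta> \<in> carrier A" and "big_e0 r \<theta> \<otimes>\<^bsub>A\<^esub> big_e0 r \<theta> = big_e0 r \<theta>"
proof -
  let ?V = "big_P r \<theta> :: ('p, ('p, 'k) big_space) rep"
  have rep: "representation big_scale r \<theta> ?V" by (rule representation_big_P[OF assms(1,2)])
  then have vs: "vector_space (big_scale :: 'k \<Rightarrow> ('p, 'k) big_space \<Rightarrow> _)"
    and sub: "module.subspace big_scale (rep_space ?V)"
    by (auto simp: representation_def)
  note sub' = vector_space_subspaceD[OF vs sub]
  have sp: "v \<in> rep_space ?V \<longleftrightarrow> fst v \<in> rep_space (rep_Sum \<theta> (rep_P r))" for v
    by (auto simp: big_P_def rep_plus_def rep_P0_def mem_Times_iff)
  have 0: "(0, c) \<in> rep_space ?V" for c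
    using sub'(1) by (simp add: sp)
  have at: "fun_map z (big_e0 r \<theta>) h \<in> rep_at ?V z" if z: "z \<in> \<theta>" and h: "h \<in> rep_at ?V z" for z h
  proof -
    have "h \<in> fun_space z (rep_space ?V)"
      using rep z h unfolding representation_def by blast
    then have "fun_map z (big_e0 r \<theta>) h = 0"
      using h by (auto simp: fun_map_def big_e0_def fun_space_def rep_at_big_P zero_prod_def)
    moreover have "module.subspace (fun_scale big_scale) (rep_at ?V z)"
      using rep z unfolding representation_def by blast
    then have "0 \<in> rep_at ?V z"
      using vector_space_subspaceD(1)[OF vector_space_fun_scale[OF vs]] by blast
    ultimately show ?thesis by simp
  qed
  show "big_e0 r \<theta> \<in> carrier A"
    using at 0 sub'(2,3)
    by (auto simp: A rep_End_def rep_hom_def big_e0_def big_scale_def prod_scale_def plus_prod_def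
        fun_scale_def zero_fun_def fun_eq_iff)
  show "big_e0 r \<theta> \<otimes>\<^bsub>A\<^esub> big_e0 r \<theta> = big_e0 r \<theta>"
    using 0 by (auto simp: A rep_End_def compose_def big_e0_def fun_eq_iff)
qed


section \<open>Right modules\<close>

text \<open>As in \<open>HOL-Algebra\<close>, modules extend the ring record in order to reuse
  \<^locale>\<open>abelian_group\<close>; the multiplicative fields carry no meaning.\<close>

record ('a, 'm) rmodule = "'m ring" +
  ract :: "'m \<Rightarrow> 'a \<Rightarrow> 'm"  (infixl "\<star>\<index>" 70)

locale right_module = R?: ring R + M?: abelian_group M
  for R (structure) and M :: "('a, 'm) rmodule" (structure) +
  assumes ract_closed:
      "\<lbrakk>x \<in> carrier M; a \<in> carrier R\<rbrakk> \<Longrightarrow> x \<star>\<^bsub>M\<^esub> a \<in> carrier M"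
    and ract_add_left:
      "\<lbrakk>x \<in> carrier M; y \<in> carrier M; a \<in> carrier R\<rbrakk> \<Longrightarrow>
       (x \<oplus>\<^bsub>M\<^esub> y) \<star>\<^bsub>M\<^esub> a = x \<star>\<^bsub>M\<^esub> a \<oplus>\<^bsub>M\<^esub> y \<star>\<^bsub>M\<^esub> a"
    and ract_add_right:
      "\<lbrakk>x \<in> carrier M; a \<in> carrier R; b \<in> carrier R\<rbrakk> \<Longrightarrow>
       x \<star>\<^bsub>M\<^esub> (a \<oplus>\<^bsub>R\<^esub> b) = x \<star>\<^bsub>M\<^esub> a \<oplus>\<^bsub>M\<^esub> x \<star>\<^bsub>M\<^esub> b"
    and ract_assoc:
      "\<lbrakk>x \<in> carrier M; a \<in> carrier R; b \<in> carrier R\<rbrakk> \<Longrightarrow>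
       x \<star>\<^bsub>M\<^esub> (a \<otimes>\<^bsub>R\<^esub> b) = (x \<star>\<^bsub>M\<^esub> a) \<star>\<^bsub>M\<^esub> b"
    and ract_one: "x \<in> carrier M \<Longrightarrow> x \<star>\<^bsub>M\<^esub> \<one>\<^bsub>R\<^esub> = x"

definition rmod_hom ::
  "'a ring \<Rightarrow> ('a, 'm) rmodule \<Rightarrow> ('a, 'n) rmodule \<Rightarrow> ('m \<Rightarrow> 'n) set" where
  "rmod_hom R M N =
     {f \<in> carrier M \<rightarrow> carrier N.
        (\<forall>x\<in>carrier M. \<forall>y\<in>carrier M. f (x \<oplus>\<^bsub>M\<^esub> y) = f x \<oplus>\<^bsub>N\<^esub> f y) \<and>
        (\<forall>x\<in>carrier M. \<forall>a\<in>carrier R. f (x \<star>\<^bsub>M\<^esub> a) = f x \<star>\<^bsub>N\<^esub> a)}"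

definition rmod_iso :: "'a ring \<Rightarrow> ('a, 'm) rmodule \<Rightarrow> ('a, 'n) rmodule \<Rightarrow> bool" where
  "rmod_iso R M N \<longleftrightarrow> (\<exists>f\<in>rmod_hom R M N. bij_betw f (carrier M) (carrier N))"

definition rsubmodule :: "'m set \<Rightarrow> 'a ring \<Rightarrow> ('a, 'm) rmodule \<Rightarrow> bool" where
  "rsubmodule N R M \<longleftrightarrow>
     N \<subseteq> carrier M \<and> \<zero>\<^bsub>M\<^esub> \<in> N \<and> (\<forall>x\<in>N. \<forall>y\<in>N. x \<oplus>\<^bsub>M\<^esub> y \<in> N) \<and>
     (\<forall>x\<in>N. \<forall>a\<in>carrier R. x \<star>\<^bsub>M\<^esub> a \<in> N)"

abbreviation submod :: "('a, 'm) rmodule \<Rightarrow> 'm set \<Rightarrow> ('a, 'm) rmodule" where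
  "submod M N \<equiv> M\<lparr>carrier := N\<rparr>"

definition simple_rmodule :: "'a ring \<Rightarrow> ('a, 'm) rmodule \<Rightarrow> bool" where
  "simple_rmodule R M \<longleftrightarrow>
     right_module R M \<and> carrier M \<noteq> {\<zero>\<^bsub>M\<^esub>} \<and>
     (\<forall>N. rsubmodule N R M \<longrightarrow> N = {\<zero>\<^bsub>M\<^esub>} \<or> N = carrier M)"

text \<open>The regular right module \<open>R\<^sub>R\<close>.\<close>

definition regular_rmodule :: "'a ring \<Rightarrow> ('a, 'a) rmodule" where
  "regular_rmodule R =
     \<lparr>carrier = carrier R, mult = mult R, one = one R, zero = zero R, add = add R, ract = mult R\<rparr>"

text \<open>The direct sum of copies of \<open>M\<close> indexed by \<open>I\<close>.\<close>

definition copower :: "'i set \<Rightarrow> ('a, 'm) rmodule \<Rightarrow> ('a, 'i \<Rightarrow> 'm) rmodule" where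
  "copower I M =
     \<lparr>carrier = {f \<in> I \<rightarrow>\<^sub>E carrier M. finite {i \<in> I. f i \<noteq> \<zero>\<^bsub>M\<^esub>}},
      mult = undefined, one = undefined,
      zero = (\<lambda>i\<in>I. \<zero>\<^bsub>M\<^esub>),
      add = (\<lambda>f g. \<lambda>i\<in>I. f i \<oplus>\<^bsub>M\<^esub> g i),
      ract = (\<lambda>f a. \<lambda>i\<in>I. f i \<star>\<^bsub>M\<^esub> a)\<rparr>"

text \<open>Projective means isomorphic to a direct summand of a free module.  Index sets inside the
  carrier type of \<open>M\<close> suffice: a projective \<open>M\<close> is a direct summand of the free module on
  \<open>carrier M\<close>.\<close>

definition projective_rmodule :: "'a ring \<Rightarrow> ('a, 'm) rmodule \<Rightarrow> bool" where
  "projective_rmodule R M \<longleftrightarrow>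
     right_module R M \<and>
     (\<exists>(I :: 'm set) N N'.
        let F = copower I (regular_rmodule R) in
          rsubmodule N R F \<and> rsubmodule N' R F \<and> N \<inter> N' = {\<zero>\<^bsub>F\<^esub>} \<and>
          (\<forall>x\<in>carrier F. \<exists>n\<in>N. \<exists>n'\<in>N'. x = n \<oplus>\<^bsub>F\<^esub> n') \<and>
          rmod_iso R M (submod F N))"

text \<open>The sum of the simple submodules, i.e. the least submodule containing all of them.\<close>

definition socle :: "'a ring \<Rightarrow> ('a, 'm) rmodule \<Rightarrow> 'm set" where
  "socle R M =
     \<Inter>{N. rsubmodule N R M \<and>
          (\<forall>S. rsubmodule S R M \<and> simple_rmodule R (submod M S) \<longrightarrow> S \<subseteq> N)}"

definition algebra_over :: "('k::field \<Rightarrow> 'a \<Rightarrow> 'a) \<Rightarrow> 'a ring \<Rightarrow> bool" where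
  "algebra_over s B \<longleftrightarrow>
     ring B \<and>
     (\<forall>c. \<forall>x\<in>carrier B. s c x \<in> carrier B) \<and>
     (\<forall>c. \<forall>x\<in>carrier B. \<forall>y\<in>carrier B. s c (x \<oplus>\<^bsub>B\<^esub> y) = s c x \<oplus>\<^bsub>B\<^esub> s c y) \<and>
     (\<forall>c d. \<forall>x\<in>carrier B. s (c + d) x = s c x \<oplus>\<^bsub>B\<^esub> s d x) \<and>
     (\<forall>c d. \<forall>x\<in>carrier B. s (c * d) x = s c (s d x)) \<and>
     (\<forall>x\<in>carrier B. s 1 x = x) \<and>
     (\<forall>c. \<forall>x\<in>carrier B. \<forall>y\<in>carrier B.
        s c (x \<otimes>\<^bsub>B\<^esub> y) = s c x \<otimes>\<^bsub>B\<^esub> y \<and> s c (x \<otimes>\<^bsub>B\<^esub> y) = x \<otimes>\<^bsub>B\<^esub> s c y)"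

text \<open>Neither type restriction matters: a simple projective module is isomorphic to a right ideal
  of \<open>B\<close>, and the number of copies of a nonzero module in \<open>soc(B\<^sub>B)\<close> is at most the size of \<open>B\<close>.\<close>

definition right_peak_algebra :: "('k::field \<Rightarrow> 'a \<Rightarrow> 'a) \<Rightarrow> 'a ring \<Rightarrow> bool" where
  "right_peak_algebra s B \<longleftrightarrow>
     algebra_over s B \<and>
     (\<exists>(S :: ('a, 'a) rmodule) (I :: 'a set).
        simple_rmodule B S \<and> projective_rmodule B S \<and>
        rmod_iso B (submod (regular_rmodule B) (socle B (regular_rmodule B))) (copower I S))"

text \<open>The right ideal \<open>eB\<close> as a right \<open>B\<close>-module.\<close>

definition principal_rmodule :: "'a \<Rightarrow> 'a ring \<Rightarrow> ('a, 'a) rmodule" where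
  "principal_rmodule e B = submod (regular_rmodule B) ((\<lambda>a. e \<otimes>\<^bsub>B\<^esub> a) ` carrier B)"

end

theory Submission
  imports Defs
begin

text \<open>
  Let \<open>u0 = (0,1)\<close> span the summand \<open>P(0)\<close> of \<open>V = big_P\<close>, let \<open>\<epsilon> = snd\<close>, and let
  \<open>T u = \<epsilon>(-) u\<close> for \<open>u \<in> V\<^sub>0\<close>. Since \<open>P(0)\<^sub>z = 0\<close>, every \<open>T u\<close> is an endomorphism, so
  \<open>A e\<^sub>0 = {T u | u \<in> V\<^sub>0}\<close> where \<open>e\<^sub>0 = T u0\<close>. Conversely \<open>V\<^sub>0\<close> is spanned by \<open>u0\<close> and the
  spaces \<open>V\<^sub>x\<^sup>+\<close>, on which \<open>\<epsilon> \<circ> a\<close> vanishes for all \<open>a \<in> A\<close>; hence \<open>e\<^sub>0 a\<close> is a scalar multiple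
  of \<open>e\<^sub>0\<close>, and \<open>e\<^sub>0 A = k e\<^sub>0\<close> is simple. If \<open>a v \<noteq> 0\<close> then \<open>a (T v) = T (a v) \<noteq> 0\<close>, so every
  nonzero right ideal meets \<open>A e\<^sub>0\<close>. This gives \<open>soc(A\<^sub>A) = A e\<^sub>0\<close>, which a basis of \<open>V\<^sub>0\<close> splits
  into copies of \<open>e\<^sub>0 A\<close>. A simple projective module has a nonzero map to \<open>A\<^sub>A\<close>, hence a nonzero
  element \<open>m e\<^sub>0\<close>, and \<open>e\<^sub>0 a \<mapsto> m e\<^sub>0 a\<close> is an isomorphism by Schur's lemma.
\<close>

section \<open>Submodules and homomorphisms of right modules, and Schur's lemma\<close>

section \<open>Right modules\<close>

text \<open>Neither \<open>rsubmodule\<close> nor \<open>rmod_hom\<close> mentions negatives. Acting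
  by minus one supplies them, so closure under addition and the action already gives closure under
  subtraction.\<close>

lemma (in right_module) ract_minus_one:
  assumes x: "x \<in> carrier M"
  shows "x \<star>\<^bsub>M\<^esub> (\<ominus>\<^bsub>R\<^esub> \<one>\<^bsub>R\<^esub>) \<oplus>\<^bsub>M\<^esub> x = \<zero>\<^bsub>M\<^esub>"
proof -
  have zero: "x \<star>\<^bsub>M\<^esub> \<zero>\<^bsub>R\<^esub> = \<zero>\<^bsub>M\<^esub>"
    using ract_add_right[OF x R.zero_closed R.zero_closed] ract_closed[OF x R.zero_closed]
    by (metis M.add.r_cancel_one' R.add.one_closed R.r_zero)
  have "x \<star>\<^bsub>M\<^esub> (\<ominus>\<^bsub>R\<^esub> \<one>\<^bsub>R\<^esub>) \<oplus>\<^bsub>M\<^esub> x = x \<star>\<^bsub>M\<^esub> (\<ominus>\<^bsub>R\<^esub> \<one>\<^bsub>R\<^esub> \<oplus>\<^bsub>R\<^esub> \<one>\<^bsub>R\<^esub>)"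
    using x by (simp add: ract_add_right ract_one)
  then show ?thesis by (simp add: R.l_neg zero)
qed

lemma right_module_submod:
  fixes R :: "'a ring" and M :: "('a, 'm) rmodule"
  assumes "right_module R M" and "rsubmodule N R M"
  shows "right_module R (submod M N)"
proof -
  interpret right_module R M by fact
  have N: "N \<subseteq> carrier M" "\<zero>\<^bsub>M\<^esub> \<in> N" "\<And>x y. x \<in> N \<Longrightarrow> y \<in> N \<Longrightarrow> x \<oplus>\<^bsub>M\<^esub> y \<in> N"
    "\<And>x a. x \<in> N \<Longrightarrow> a \<in> carrier R \<Longrightarrow> x \<star>\<^bsub>M\<^esub> a \<in> N"
    using assms(2) by (auto simp: rsubmodule_def)
  note NM = subsetD[OF N(1)]
  have "abelian_group (submod M N)"
  proof (rule abelian_groupI)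
    fix x assume "x \<in> carrier (submod M N)"
    then show "\<exists>y\<in>carrier (submod M N). y \<oplus>\<^bsub>submod M N\<^esub> x = \<zero>\<^bsub>submod M N\<^esub>"
      using ract_minus_one[of x] N NM by (intro bexI[of _ "x \<star>\<^bsub>M\<^esub> (\<ominus>\<^bsub>R\<^esub> \<one>\<^bsub>R\<^esub>)"]) auto
  qed (use N NM in \<open>auto simp: M.a_assoc M.a_comm M.a_lcomm\<close>)
  then show ?thesis
    using N NM
    by (intro right_module.intro R.ring_axioms right_module_axioms.intro)
      (auto simp: ract_add_left ract_add_right ract_assoc ract_one)
qed

lemma rsubmodule_submod_iff:
  assumes "rsubmodule N R M"
  shows "rsubmodule K R (submod M N) \<longleftrightarrow> rsubmodule K R M \<and> K \<subseteq> N"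
  using assms by (auto simp: rsubmodule_def)

lemma ring_imp_right_module_regular:
  fixes R :: "'a ring"
  assumes "ring R"
  shows "right_module R (regular_rmodule R)"
proof -
  interpret ring R by fact
  have "abelian_group (regular_rmodule R)"
    by (rule abelian_groupI)
      (auto simp: regular_rmodule_def a_assoc a_comm a_lcomm intro: l_neg bexI[of _ "\<ominus>\<^bsub>R\<^esub> _"])
  then show ?thesis
    by (intro right_module.intro ring_axioms right_module_axioms.intro)
      (auto simp: regular_rmodule_def l_distr r_distr m_assoc)
qed

lemma rmod_hom_zero:
  assumes "right_module R M" "right_module R N" "f \<in> rmod_hom R M N"
  shows "f \<zero>\<^bsub>M\<^esub> = \<zero>\<^bsub>N\<^esub>"
proof -
  interpret M: right_module R M by fact
  interpret N: right_module R N by fact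
  have "f \<zero>\<^bsub>M\<^esub> \<oplus>\<^bsub>N\<^esub> f \<zero>\<^bsub>M\<^esub> = f \<zero>\<^bsub>M\<^esub>" "f \<zero>\<^bsub>M\<^esub> \<in> carrier N"
    using assms(3) M.M.zero_closed M.M.l_zero[OF M.M.zero_closed]
    unfolding rmod_hom_def by (force, blast)
  then show ?thesis using N.M.add.r_cancel_one' by metis
qed

lemma rsubmodule_vimage:
  assumes M: "right_module R M" and N: "right_module R N" and f: "f \<in> rmod_hom R M N"
    and K: "rsubmodule K R N"
  shows "rsubmodule {x \<in> carrier M. f x \<in> K} R M"
proof -
  interpret M: right_module R M by fact
  show ?thesis
    using f K rmod_hom_zero[OF M N f] M.ract_closed
    by (auto simp: rsubmodule_def rmod_hom_def)
qed

lemma rsubmodule_zero: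
  assumes "right_module R M"
  shows "rsubmodule {\<zero>\<^bsub>M\<^esub>} R M"
proof -
  interpret right_module R M by fact
  have "\<zero>\<^bsub>M\<^esub> \<star>\<^bsub>M\<^esub> a = \<zero>\<^bsub>M\<^esub>" if "a \<in> carrier R" for a
    using ract_add_left[OF M.zero_closed M.zero_closed that] ract_closed[OF M.zero_closed that]
    by (metis M.add.r_cancel_one' M.zero_closed M.l_zero)
  then show ?thesis by (auto simp: rsubmodule_def)
qed

lemma rsubmodule_image:
  assumes M: "right_module R M" and N: "right_module R N" and f: "f \<in> rmod_hom R M N"
  shows "rsubmodule (f ` carrier M) R N"
proof -
  interpret M: right_module R M by fact
  have add: "f x \<oplus>\<^bsub>N\<^esub> f y = f (x \<oplus>\<^bsub>M\<^esub> y)" if "x \<in> carrier M" "y \<in> carrier M" for x y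
    using f that by (simp add: rmod_hom_def)
  have act: "f x \<star>\<^bsub>N\<^esub> a = f (x \<star>\<^bsub>M\<^esub> a)" if "x \<in> carrier M" "a \<in> carrier R" for x a
    using f that by (simp add: rmod_hom_def)
  have zero: "\<zero>\<^bsub>N\<^esub> \<in> f ` carrier M"
    using rmod_hom_zero[OF M N f] M.M.zero_closed by (metis imageI)
  show ?thesis
    using f zero by (auto simp: rsubmodule_def add act M.ract_closed) (auto simp: rmod_hom_def)
qed

text \<open>A single element with nonzero image is enough: the kernel is then a proper submodule,
  hence zero, and the image is a nonzero submodule, hence all of \<open>N\<close>.\<close>

lemma schur:
  assumes M: "simple_rmodule R M" and N: "simple_rmodule R N" and f: "f \<in> rmod_hom R M N"
    and x: "x \<in> carrier M" "f x \<noteq> \<zero>\<^bsub>N\<^esub>"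
  shows "bij_betw f (carrier M) (carrier N)"
proof -
  have MN: "right_module R M" "right_module R N" using M N by (auto simp: simple_rmodule_def)
  interpret M: right_module R M by fact
  interpret N: right_module R N by fact
  have "rsubmodule {x \<in> carrier M. f x \<in> {\<zero>\<^bsub>N\<^esub>}} R M"
    by (rule rsubmodule_vimage[OF MN f rsubmodule_zero[OF MN(2)]])
  then have ker: "{x \<in> carrier M. f x \<in> {\<zero>\<^bsub>N\<^esub>}} = {\<zero>\<^bsub>M\<^esub>}"
    using M x unfolding simple_rmodule_def by blast
  have "inj_on f (carrier M)"
  proof (rule inj_onI)
    fix y z assume yz: "y \<in> carrier M" "z \<in> carrier M" "f y = f z"
    \<comment> \<open>\<open>?z\<close> is -z, so the sum formed below is y - z, which
      \<open>f\<close> sends to zero.\<close>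
    let ?z = "z \<star>\<^bsub>M\<^esub> (\<ominus>\<^bsub>R\<^esub> \<one>\<^bsub>R\<^esub>)"
    have z: "?z \<in> carrier M" using yz by (simp add: M.ract_closed)
    have fz: "f ?z = f z \<star>\<^bsub>N\<^esub> (\<ominus>\<^bsub>R\<^esub> \<one>\<^bsub>R\<^esub>)" "f (?z \<oplus>\<^bsub>M\<^esub> y) = f ?z \<oplus>\<^bsub>N\<^esub> f y"
      using f yz z by (auto simp: rmod_hom_def)
    have "f z \<in> carrier N" using f yz by (auto simp: rmod_hom_def)
    then have "f (?z \<oplus>\<^bsub>M\<^esub> y) = \<zero>\<^bsub>N\<^esub>"
      unfolding fz yz(3) by (rule N.ract_minus_one)
    then have "?z \<oplus>\<^bsub>M\<^esub> y = \<zero>\<^bsub>M\<^esub>" using ker yz z by blast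
    then have "?z \<oplus>\<^bsub>M\<^esub> y = ?z \<oplus>\<^bsub>M\<^esub> z" using M.ract_minus_one yz by simp
    then show "y = z" using yz z by simp
  qed
  moreover have "f ` carrier M = carrier N"
    using N rsubmodule_image[OF MN f] x unfolding simple_rmodule_def by blast
  ultimately show ?thesis by (simp add: bij_betw_def)
qed

text \<open>Surjectivity makes every submodule \<open>K\<close> of \<open>N\<close> the image of its
  preimage, and by simplicity the preimage is zero or all of \<open>M\<close>.\<close>

lemma simple_rmodule_image:
  assumes M: "simple_rmodule R M" and N: "right_module R N" and f: "f \<in> rmod_hom R M N"
    and surj: "f ` carrier M = carrier N" and nz: "carrier N \<noteq> {\<zero>\<^bsub>N\<^esub>}"
  shows "simple_rmodule R N"
  unfolding simple_rmodule_def
proof (intro conjI allI impI N nz)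
  fix K assume K: "rsubmodule K R N"
  have M': "right_module R M" using M by (simp add: simple_rmodule_def)
  from rsubmodule_vimage[OF M' N f K] M
  have "{x \<in> carrier M. f x \<in> K} = {\<zero>\<^bsub>M\<^esub>} \<or> {x \<in> carrier M. f x \<in> K} = carrier M"
    by (simp add: simple_rmodule_def)
  then have "f ` {x \<in> carrier M. f x \<in> K} \<in> {{\<zero>\<^bsub>N\<^esub>}, carrier N}"
    using rmod_hom_zero[OF M' N f] surj by (elim disjE) simp_all
  moreover have "f ` {x \<in> carrier M. f x \<in> K} = K"
    using surj K by (auto simp: rsubmodule_def)
  ultimately show "K = {\<zero>\<^bsub>N\<^esub>} \<or> K = carrier N" by simp
qed

lemma rmod_iso_sym:
  assumes M: "right_module R M" and "rmod_iso R M N"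
  shows "rmod_iso R N M"
proof -
  interpret M: right_module R M by fact
  from assms obtain f where f: "f \<in> rmod_hom R M N" and bij: "bij_betw f (carrier M) (carrier N)"
    by (auto simp: rmod_iso_def)
  let ?g = "the_inv_into (carrier M) f"
  have g: "?g y \<in> carrier M" "f (?g y) = y" if "y \<in> carrier N" for y
    using bij that by (auto simp: bij_betw_def intro: the_inv_into_into f_the_inv_into_f)
  have gI: "?g y = x" if "x \<in> carrier M" "f x = y" for x y
    using bij that by (auto simp: bij_betw_def intro: the_inv_into_f_eq)
  have "?g \<in> rmod_hom R N M"
    using f g unfolding rmod_hom_def
    by (auto intro!: gI M.ract_closed)
  moreover have "bij_betw ?g (carrier N) (carrier M)" by (rule bij_betw_the_inv_into[OF bij])
  ultimately show ?thesis by (auto simp: rmod_iso_def)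
qed

section \<open>Projectivity of eR, the socle, and simple projective modules over a ring\<close>

section \<open>Principal right ideals generated by idempotents\<close>

text \<open>\<^typ>\<open>('a, 'm) rmodule\<close> is a module over an unextended ring record, whereas \<^locale>\<open>ring\<close>
  fixes a ring scheme.\<close>

locale plain_ring = ring R for R :: "'a ring" (structure)
begin

lemma rsubmodule_principal:
  assumes "x \<in> carrier R"
  shows "rsubmodule ((\<otimes>) x ` carrier R) R (regular_rmodule R)"
proof -
  have "x \<otimes> a \<oplus> x \<otimes> b \<in> (\<otimes>) x ` carrier R" if "a \<in> carrier R" "b \<in> carrier R" for a b
    using that assms by (metis r_distr add.m_closed imageI)
  moreover have "x \<otimes> a \<otimes> b \<in> (\<otimes>) x ` carrier R" if "a \<in> carrier R" "b \<in> carrier R" for a b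
    using that assms by (metis m_assoc m_closed imageI)
  moreover have "\<zero> \<in> (\<otimes>) x ` carrier R"
    using assms by (metis r_null zero_closed imageI)
  ultimately show ?thesis
    using assms by (auto simp: rsubmodule_def regular_rmodule_def)
qed

lemma right_module_principal: "x \<in> carrier R \<Longrightarrow> right_module R (principal_rmodule x R)"
  unfolding principal_rmodule_def
  using right_module_submod[OF ring_imp_right_module_regular[OF ring_axioms]]
    rsubmodule_principal by blast

text \<open>The decomposition of R into eR and (1 - e)R exhibits eR as a summand of the free module
  of rank one. The index set \<open>{e}\<close> is a singleton of the type that
  \<open>projective_rmodule\<close> prescribes.\<close>

lemma projective_principal:
  assumes e: "e \<in> carrier R" "e \<otimes> e = e"
  shows "projective_rmodule R (principal_rmodule e R)"
proof -
  let ?F = "copower {e} (regular_rmodule R)"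
  \<comment> \<open>For an idempotent \<open>c\<close> the equation cx = x describes the right ideal
    cR, so \<open>?N e\<close> and \<open>?N e'\<close> are copies of eR and (1 - e)R.\<close>
  let ?N = "\<lambda>c. {f \<in> carrier ?F. c \<otimes> f e = f e}"
  define e' where "e' = \<one> \<ominus> e"
  have e': "e' \<in> carrier R" using e by (simp add: e'_def)
  have F: "f \<in> carrier ?F \<longleftrightarrow> f \<in> {e} \<rightarrow>\<^sub>E carrier R" for f
    by (simp add: copower_def regular_rmodule_def)
  have sub: "rsubmodule (?N c) R ?F" if "c \<in> carrier R" for c
    using that
    by (auto simp: rsubmodule_def F PiE_iff extensional_def r_distr m_assoc[symmetric])
      (auto simp: copower_def regular_rmodule_def r_distr m_assoc[symmetric])
  have e'': "e' \<otimes> x = x \<ominus> e \<otimes> x" "e \<otimes> (x \<ominus> e \<otimes> x) = \<zero>" if "x \<in> carrier R" for x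
  proof -
    show "e' \<otimes> x = x \<ominus> e \<otimes> x" using e that by (simp add: e'_def minus_eq l_distr l_minus)
    have "e \<otimes> (e \<otimes> x) = e \<otimes> x" using e that by (simp add: m_assoc[symmetric])
    then show "e \<otimes> (x \<ominus> e \<otimes> x) = \<zero>"
      using e that by (simp add: minus_eq r_distr r_minus r_neg)
  qed
  have int: "?N e \<inter> ?N e' = {\<zero>\<^bsub>?F\<^esub>}"
  proof (intro equalityI subsetI)
    fix f assume f: "f \<in> ?N e \<inter> ?N e'"
    then have "f e \<in> carrier R" "e \<otimes> f e = f e" "e' \<otimes> f e = f e" by (auto simp: F)
    then have "f e = \<zero>" using e''[of "f e"] by (simp add: minus_eq r_neg)
    then show "f \<in> {\<zero>\<^bsub>?F\<^esub>}"
      using f by (auto simp: F PiE_iff extensional_def copower_def regular_rmodule_def)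
  qed (use e e' in \<open>auto simp: F copower_def regular_rmodule_def\<close>)
  have dec: "\<exists>n\<in>?N e. \<exists>n'\<in>?N e'. f = n \<oplus>\<^bsub>?F\<^esub> n'" if f: "f \<in> carrier ?F" for f
  proof (intro bexI)
    have fe: "f e \<in> carrier R" using f by (auto simp: F)
    have "e \<otimes> f e \<oplus> (f e \<ominus> e \<otimes> f e) = f e"
      using fe e by (simp add: minus_eq) (metis a_lcomm a_inv_closed m_closed r_neg r_zero)
    then show "f = (\<lambda>i\<in>{e}. e \<otimes> f e) \<oplus>\<^bsub>?F\<^esub> (\<lambda>i\<in>{e}. f e \<ominus> e \<otimes> f e)"
      using f by (auto simp: F PiE_iff extensional_def copower_def regular_rmodule_def fun_eq_iff)
    show "(\<lambda>i\<in>{e}. e \<otimes> f e) \<in> ?N e"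
      using fe e by (auto simp: F m_assoc[symmetric])
    show "(\<lambda>i\<in>{e}. f e \<ominus> e \<otimes> f e) \<in> ?N e'"
      using fe e e''(1)[of "f e \<ominus> e \<otimes> f e"] e''(2)[OF fe] by (auto simp: F minus_eq)
  qed
  have in_N: "(\<lambda>i\<in>{e}. x) \<in> carrier (submod ?F (?N e))" if "x \<in> carrier (principal_rmodule e R)" for x
  proof -
    have "x \<in> carrier R \<and> e \<otimes> x = x"
      using e that by (auto simp: principal_rmodule_def m_assoc[symmetric])
    then show ?thesis by (simp add: F restrict_PiE_iff)
  qed
  have iso: "rmod_iso R (principal_rmodule e R) (submod ?F (?N e))"
    unfolding rmod_iso_def
  proof (intro bexI)
    show "bij_betw (\<lambda>x. \<lambda>i\<in>{e}. x) (carrier (principal_rmodule e R)) (carrier (submod ?F (?N e)))"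
    proof (rule bij_betw_byWitness[where f' = "\<lambda>f. f e"])
      show "(\<lambda>f. f e) ` carrier (submod ?F (?N e)) \<subseteq> carrier (principal_rmodule e R)"
        by (auto simp: principal_rmodule_def F) (metis PiE_mem image_eqI singletonI)
      show "\<forall>f\<in>carrier (submod ?F (?N e)). (\<lambda>i\<in>{e}. f e) = f"
        by (auto simp: F PiE_iff extensional_def fun_eq_iff)
      show "(\<lambda>x. \<lambda>i\<in>{e}. x) ` carrier (principal_rmodule e R) \<subseteq> carrier (submod ?F (?N e))"
        using in_N by blast
    qed simp
    show "(\<lambda>x. \<lambda>i\<in>{e}. x) \<in> rmod_hom R (principal_rmodule e R) (submod ?F (?N e))"
      unfolding rmod_hom_def mem_Collect_eq
    proof (intro conjI funcsetI ballI in_N)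
      fix x y
      show "(\<lambda>i\<in>{e}. x \<oplus>\<^bsub>principal_rmodule e R\<^esub> y) =
          (\<lambda>i\<in>{e}. x) \<oplus>\<^bsub>submod ?F (?N e)\<^esub> (\<lambda>i\<in>{e}. y)"
        by (simp add: copower_def regular_rmodule_def principal_rmodule_def fun_eq_iff)
      show "(\<lambda>i\<in>{e}. x \<star>\<^bsub>principal_rmodule e R\<^esub> y) =
          (\<lambda>i\<in>{e}. x) \<star>\<^bsub>submod ?F (?N e)\<^esub> y"
        by (simp add: copower_def regular_rmodule_def principal_rmodule_def fun_eq_iff)
    qed
  qed
  show ?thesis
    unfolding projective_rmodule_def Let_def
    using right_module_principal[OF e(1)] sub[OF e(1)] sub[OF e'] int dec iso by blast
qed

text \<open>Left multiplication by \<open>a\<close> is right linear and maps eR onto aeR, which is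
  therefore a nonzero image of a simple module.\<close>

lemma simple_principal_image:
  assumes simple: "simple_rmodule R (principal_rmodule e R)"
    and e: "e \<in> carrier R" and a: "a \<in> carrier R" "a \<otimes> e \<noteq> \<zero>"
  shows "simple_rmodule R (principal_rmodule (a \<otimes> e) R)"
proof (rule simple_rmodule_image[OF simple])
  show "right_module R (principal_rmodule (a \<otimes> e) R)"
    using e a by (simp add: right_module_principal)
  have eq: "a \<otimes> (e \<otimes> b) = (a \<otimes> e) \<otimes> b" if "b \<in> carrier R" for b
    using e a that by (simp add: m_assoc)
  show "(\<otimes>) a \<in> rmod_hom R (principal_rmodule e R) (principal_rmodule (a \<otimes> e) R)"
    using e a by (auto simp: rmod_hom_def principal_rmodule_def regular_rmodule_def r_distr eq)
      (simp_all add: m_assoc)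
  show "(\<otimes>) a ` carrier (principal_rmodule e R) = carrier (principal_rmodule (a \<otimes> e) R)"
    by (auto simp: principal_rmodule_def image_image eq cong: image_cong)
  have "a \<otimes> e \<in> carrier (principal_rmodule (a \<otimes> e) R)"
    using e a by (auto simp: principal_rmodule_def intro!: image_eqI[of _ _ \<one>])
  then show "carrier (principal_rmodule (a \<otimes> e) R) \<noteq> {\<zero>\<^bsub>principal_rmodule (a \<otimes> e) R\<^esub>}"
    using a by (auto simp: principal_rmodule_def regular_rmodule_def)
qed

text \<open>By \<open>ideal\<close>, Re is a right ideal. By \<open>faithful\<close>, every simple
  right ideal meets Re nontrivially and hence lies in it. Conversely, a nonzero element ae lies in
  the simple right ideal aeR, so Re is contained in the socle.\<close>

lemma socle_regular:
  assumes simple: "simple_rmodule R (principal_rmodule e R)" and e: "e \<in> carrier R"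
    and faithful: "\<And>a. a \<in> carrier R \<Longrightarrow> a \<noteq> \<zero> \<Longrightarrow> \<exists>b\<in>carrier R. a \<otimes> b \<otimes> e \<noteq> \<zero>"
    and ideal: "\<And>a. a \<in> carrier R \<Longrightarrow> \<exists>b\<in>carrier R. e \<otimes> a = b \<otimes> e"
  shows "socle R (regular_rmodule R) = (\<lambda>b. b \<otimes> e) ` carrier R"
    (is "socle R ?R = ?L")
proof -
  let ?I = "{N. rsubmodule N R ?R \<and> (\<forall>S. rsubmodule S R ?R \<and> simple_rmodule R (submod ?R S) \<longrightarrow> S \<subseteq> N)}"
  interpret RM: right_module R ?R by (rule ring_imp_right_module_regular[OF ring_axioms])
  have L: "rsubmodule ?L R ?R"
  proof -
    have "b \<otimes> e \<otimes> a \<in> ?L" if ab: "b \<in> carrier R" "a \<in> carrier R" for a b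
    proof -
      obtain c where "c \<in> carrier R" "e \<otimes> a = c \<otimes> e" using ideal ab by blast
      then have "b \<otimes> e \<otimes> a = (b \<otimes> c) \<otimes> e" using ab e by (simp add: m_assoc)
      then show ?thesis using ab \<open>c \<in> carrier R\<close> by blast
    qed
    moreover have "b \<otimes> e \<oplus> a \<otimes> e \<in> ?L" if "b \<in> carrier R" "a \<in> carrier R" for a b
      using that e by (intro image_eqI[of _ _ "b \<oplus> a"]) (auto simp: l_distr)
    moreover have "\<zero> \<in> ?L" using e by (intro image_eqI[of _ _ \<zero>]) auto
    ultimately show ?thesis using e by (auto simp: rsubmodule_def regular_rmodule_def)
  qed
  have "S \<subseteq> ?L" if S: "rsubmodule S R ?R" "simple_rmodule R (submod ?R S)" for S
  proof -
    have S': "S \<subseteq> carrier R" "\<zero> \<in> S" "\<And>x a. x \<in> S \<Longrightarrow> a \<in> carrier R \<Longrightarrow> x \<otimes> a \<in> S"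
      using S(1) by (auto simp: rsubmodule_def regular_rmodule_def)
    have "S \<noteq> {\<zero>}" using S(2) by (simp add: simple_rmodule_def regular_rmodule_def)
    then obtain a where a: "a \<in> S" "a \<noteq> \<zero>" using S' by blast
    then obtain b where b: "b \<in> carrier R" "a \<otimes> b \<otimes> e \<noteq> \<zero>" using faithful S' by blast
    have "rsubmodule (?L \<inter> S) R ?R"
      using L S(1) by (auto simp: rsubmodule_def)
    then have "rsubmodule (?L \<inter> S) R (submod ?R S)"
      using rsubmodule_submod_iff[OF S(1)] by blast
    then have "?L \<inter> S = {\<zero>} \<or> ?L \<inter> S = S"
      using S(2) unfolding simple_rmodule_def by (simp add: regular_rmodule_def)
    moreover have "a \<otimes> b \<otimes> e \<in> ?L \<inter> S" using S' a b e by (auto simp: subset_iff)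
    ultimately show ?thesis using b by blast
  qed
  then have in_I: "?L \<in> ?I" using L by simp
  have "?L \<subseteq> N"
    if N: "rsubmodule N R ?R"
      "\<forall>S. rsubmodule S R ?R \<and> simple_rmodule R (submod ?R S) \<longrightarrow> S \<subseteq> N" for N
  proof safe
    fix a assume a: "a \<in> carrier R"
    show "a \<otimes> e \<in> N"
    proof (cases "a \<otimes> e = \<zero>")
      case True
      then show ?thesis using N(1) by (simp add: rsubmodule_def regular_rmodule_def)
    next
      case False
      then have "(\<otimes>) (a \<otimes> e) ` carrier R \<subseteq> N"
        using N(2) simple_principal_image[OF simple e a] rsubmodule_principal[of "a \<otimes> e"] a e
        by (simp add: principal_rmodule_def)
      moreover have "a \<otimes> e \<otimes> \<one> \<in> (\<otimes>) (a \<otimes> e) ` carrier R" by blast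
      ultimately show ?thesis using a e by auto
    qed
  qed
  then have least: "\<And>N. N \<in> ?I \<Longrightarrow> ?L \<subseteq> N" by simp
  show ?thesis
    unfolding socle_def by (rule subset_antisym[OF Inter_lower[OF in_I] Inter_greatest[OF least]])
qed

text \<open>Embed \<open>M\<close> into a free module. A nonzero \<open>m\<close> has a nonzero
  coordinate there, and \<open>faithful\<close> gives \<open>b\<close> such that this coordinate
  times be is nonzero. So mbe is nonzero, and x -> mbx is a nonzero map from eR to \<open>M\<close>,
  to which Schur's lemma applies.\<close>

lemma simple_projective_iso_principal:
  fixes M :: "('a, 'm) rmodule"
  assumes simple: "simple_rmodule R (principal_rmodule e R)" and e: "e \<in> carrier R"
    and faithful: "\<And>a. a \<in> carrier R \<Longrightarrow> a \<noteq> \<zero> \<Longrightarrow> \<exists>b\<in>carrier R. a \<otimes> b \<otimes> e \<noteq> \<zero>"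
    and M: "simple_rmodule R M" "projective_rmodule R M"
  shows "rmod_iso R M (principal_rmodule e R)"
proof -
  have M': "right_module R M" using M by (simp add: simple_rmodule_def)
  interpret M: right_module R M by (rule M')
  obtain I :: "'m set" and N h where N: "rsubmodule N R (copower I (regular_rmodule R))"
    and h: "h \<in> rmod_hom R M (submod (copower I (regular_rmodule R)) N)"
      "bij_betw h (carrier M) N"
    using M(2) by (auto simp: projective_rmodule_def Let_def rmod_iso_def)
  let ?F = "copower I (regular_rmodule R)"
  have hF: "h m \<in> carrier ?F" if "m \<in> carrier M" for m
    using N h(1) that by (auto simp: rsubmodule_def rmod_hom_def)
  have hc: "h m i \<in> carrier R" if "m \<in> carrier M" "i \<in> I" for m i
    using hF[OF that(1)] that(2) by (auto simp: copower_def regular_rmodule_def)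
  have hact: "h (m \<star>\<^bsub>M\<^esub> a) i = h m i \<otimes> a" if "m \<in> carrier M" "i \<in> I" "a \<in> carrier R" for m i a
    using h(1) that by (simp add: rmod_hom_def copower_def regular_rmodule_def)
  have hadd: "h (m \<oplus>\<^bsub>M\<^esub> m') i = h m i \<oplus> h m' i"
    if "m \<in> carrier M" "m' \<in> carrier M" "i \<in> I" for m m' i
    using h(1) that by (simp add: rmod_hom_def copower_def regular_rmodule_def)
  have h0: "h \<zero>\<^bsub>M\<^esub> i = \<zero>" if "i \<in> I" for i
    using hadd[OF M.M.zero_closed M.M.zero_closed that] hc[OF M.M.zero_closed that]
    by (metis M.M.l_zero M.M.zero_closed add.r_cancel_one')
  obtain m where m: "m \<in> carrier M" "m \<noteq> \<zero>\<^bsub>M\<^esub>"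
    using M(1) M.M.zero_closed unfolding simple_rmodule_def by blast
  have "\<exists>i\<in>I. h m i \<noteq> \<zero>"
  proof (rule ccontr)
    assume "\<not> (\<exists>i\<in>I. h m i \<noteq> \<zero>)"
    \<comment> \<open>Elements of the copower are extensional on \<open>I\<close>, so two of them
      with equal coordinates are equal; this contradicts injectivity of \<open>h\<close>.\<close>
    then have "h m = h \<zero>\<^bsub>M\<^esub>"
      using h0 hF[OF m(1)] hF[OF M.M.zero_closed]
      by (auto simp: copower_def regular_rmodule_def PiE_iff intro!: extensionalityI)
    then show False using h(2) m M.M.zero_closed by (auto simp: bij_betw_def inj_on_def)
  qed
  then obtain i b where i: "i \<in> I" and b: "b \<in> carrier R" "h m i \<otimes> b \<otimes> e \<noteq> \<zero>"
    using faithful hc m by blast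
  let ?m = "m \<star>\<^bsub>M\<^esub> b"
  have me: "?m \<star>\<^bsub>M\<^esub> e \<noteq> \<zero>\<^bsub>M\<^esub>"
    using hact[OF M.ract_closed i e, of m b] hact[OF m(1) i b(1)] h0[OF i] b m by auto
  have f: "(\<lambda>x. ?m \<star>\<^bsub>M\<^esub> x) \<in> rmod_hom R (principal_rmodule e R) M"
    using e m b
    by (auto simp: rmod_hom_def principal_rmodule_def regular_rmodule_def M.ract_closed
        M.ract_add_right M.ract_assoc)
  have "e \<in> carrier (principal_rmodule e R)"
    using e by (auto simp: principal_rmodule_def intro!: image_eqI[of _ _ \<one>])
  then have "bij_betw (\<lambda>x. ?m \<star>\<^bsub>M\<^esub> x) (carrier (principal_rmodule e R)) (carrier M)"
    using schur[OF simple M(1) f] me by blast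
  then have "rmod_iso R (principal_rmodule e R) M" using f by (auto simp: rmod_iso_def)
  then show ?thesis using rmod_iso_sym right_module_principal[OF e] by blast
qed

end

section \<open>Endomorphism algebras and their endomorphisms of rank at most one\<close>

section \<open>Endomorphism algebras of representations\<close>

text \<open>Endomorphisms are extensional functions, so \<open>ext\<close> reduces each algebra law
  to an identity at vectors of the space. Closure holds because \<open>fun_map\<close> on each V_z
  turns the algebra operations into the operations of V_z and composition.\<close>

lemma algebra_over_rep_End:
  fixes s :: "'k::field \<Rightarrow> 'v::ab_group_add \<Rightarrow> 'v" and V :: "('p, 'v) rep"
  assumes rep: "representation s r \<theta> V"
  shows "algebra_over (rep_End_scale s V) (rep_End s \<theta> V)"
proof -
  let ?V = "rep_space V" and ?E = "rep_End s \<theta> V"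
  have vs: "vector_space s" and sub: "module.subspace s ?V"
    and at: "\<And>z. z \<in> \<theta> \<Longrightarrow> module.subspace (fun_scale s) (rep_at V z)"
    and supp: "\<And>z h x. z \<in> \<theta> \<Longrightarrow> h \<in> rep_at V z \<Longrightarrow> x \<in> z \<Longrightarrow> h x \<in> ?V"
    and supp0: "\<And>z h x. z \<in> \<theta> \<Longrightarrow> h \<in> rep_at V z \<Longrightarrow> x \<notin> z \<Longrightarrow> h x = 0"
    using rep unfolding representation_def fun_space_def by blast+
  interpret s: vector_space s by (rule vs)
  note sub' = vector_space_subspaceD[OF vs sub]
  note at' = vector_space_subspaceD[OF vector_space_fun_scale[OF vs] at]
  have carr: "f \<in> carrier ?E \<longleftrightarrow> f \<in> extensional ?V \<and> (\<forall>v\<in>?V. f v \<in> ?V) \<and>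
      (\<forall>u\<in>?V. \<forall>v\<in>?V. f (u + v) = f u + f v) \<and> (\<forall>c. \<forall>v\<in>?V. f (s c v) = s c (f v)) \<and>
      (\<forall>z\<in>\<theta>. \<forall>h\<in>rep_at V z. fun_map z f h \<in> rep_at V z)" for f
    unfolding rep_End_def rep_hom_def by (simp add: PiE_iff image_subset_iff) blast
  have mult: "f \<otimes>\<^bsub>?E\<^esub> g = (\<lambda>v\<in>?V. f (g v))" and add: "f \<oplus>\<^bsub>?E\<^esub> g = (\<lambda>v\<in>?V. f v + g v)"
    and one: "\<one>\<^bsub>?E\<^esub> = (\<lambda>v\<in>?V. v)" and zero: "\<zero>\<^bsub>?E\<^esub> = (\<lambda>v\<in>?V. 0)"
    and scale: "rep_End_scale s V c f = (\<lambda>v\<in>?V. s c (f v))" for c f g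
    by (simp_all add: rep_End_def compose_def rep_End_scale_def)
  have zero_closed: "\<zero>\<^bsub>?E\<^esub> \<in> carrier ?E"
  proof -
    have "fun_map z (\<lambda>v\<in>?V. 0 :: 'v) h = 0" if "z \<in> \<theta>" "h \<in> rep_at V z" for z h
      using supp[OF that] by (auto simp: fun_map_def fun_eq_iff)
    then show ?thesis using sub' at' by (simp add: carr zero)
  qed
  have one_closed: "\<one>\<^bsub>?E\<^esub> \<in> carrier ?E"
  proof -
    \<comment> \<open>Outside \<open>z\<close> the left side is 0 by definition, and
      \<open>h\<close> vanishes there by \<open>supp0\<close>.\<close>
    have "fun_map z (\<lambda>v\<in>?V. v) h = h" if "z \<in> \<theta>" "h \<in> rep_at V z" for z h
      using supp[OF that] supp0[OF that] by (auto simp: fun_map_def fun_eq_iff)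
    then show ?thesis using sub' by (simp add: carr one)
  qed
  have add_closed: "f \<oplus>\<^bsub>?E\<^esub> g \<in> carrier ?E" if "f \<in> carrier ?E" "g \<in> carrier ?E" for f g
  proof -
    have "fun_map z (\<lambda>v\<in>?V. f v + g v) h = fun_map z f h + fun_map z g h"
      if "z \<in> \<theta>" "h \<in> rep_at V z" for z h
      using supp[OF that] by (auto simp: fun_map_def fun_eq_iff)
    then show ?thesis
      using that sub' at'(2) by (simp add: carr add s.scale_right_distrib add_ac)
  qed
  have mult_closed: "f \<otimes>\<^bsub>?E\<^esub> g \<in> carrier ?E" if "f \<in> carrier ?E" "g \<in> carrier ?E" for f g
  proof -
    have "fun_map z (\<lambda>v\<in>?V. f (g v)) h = fun_map z f (fun_map z g h)"
      if "z \<in> \<theta>" "h \<in> rep_at V z" for z h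
      using supp[OF that] by (auto simp: fun_map_def fun_eq_iff)
    then show ?thesis
      using that sub' by (simp add: carr mult)
  qed
  have scale_closed: "rep_End_scale s V c f \<in> carrier ?E" if "f \<in> carrier ?E" for c f
  proof -
    have "fun_map z (\<lambda>v\<in>?V. s c (f v)) h = fun_scale s c (fun_map z f h)"
      if "z \<in> \<theta>" "h \<in> rep_at V z" for z h
      using supp[OF that] by (auto simp: fun_map_def fun_scale_def fun_eq_iff)
    then show ?thesis
      using that sub' at'(3) by (simp add: carr scale s.scale_right_distrib mult.commute)
  qed
  have ext: "f = g" if "f \<in> carrier ?E" "g \<in> carrier ?E" "\<And>v. v \<in> ?V \<Longrightarrow> f v = g v" for f g
    using that by (auto simp: carr intro: extensionalityI)
  have val: "f v \<in> ?V" if "f \<in> carrier ?E" "v \<in> ?V" for f v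
    using that by (simp add: carr)
  have val_add: "f (u + v) = f u + f v" if "f \<in> carrier ?E" "u \<in> ?V" "v \<in> ?V" for f u v
    using that by (simp add: carr)
  have val_scale: "f (s c v) = s c (f v)" if "f \<in> carrier ?E" "v \<in> ?V" for f c v
    using that by (simp add: carr)
  note closed = zero_closed one_closed add_closed mult_closed scale_closed
  have ev: "(f \<otimes>\<^bsub>?E\<^esub> g) v = f (g v)" "(f \<oplus>\<^bsub>?E\<^esub> g) v = f v + g v" "\<one>\<^bsub>?E\<^esub> v = v" "\<zero>\<^bsub>?E\<^esub> v = 0"
    "rep_End_scale s V c f v = s c (f v)" if "v \<in> ?V" for f g v c
    using that by (simp_all add: mult add one zero scale)
  note ev' = ev val val_add val_scale sub'
  have "abelian_group ?E"
  proof (rule abelian_groupI)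
    fix f assume f: "f \<in> carrier ?E"
    have "rep_End_scale s V (- 1) f \<oplus>\<^bsub>?E\<^esub> f = \<zero>\<^bsub>?E\<^esub>"
      using f by (intro ext closed) (simp_all add: ev')
    then show "\<exists>g\<in>carrier ?E. g \<oplus>\<^bsub>?E\<^esub> f = \<zero>\<^bsub>?E\<^esub>"
      using scale_closed[OF f] by blast
  qed (auto intro!: ext simp: closed ev' add_ac)
  moreover have "monoid ?E"
    by (rule monoidI) (auto intro!: ext simp: closed ev')
  ultimately have "ring ?E"
    by (rule ringI) (auto intro!: ext simp: closed ev')
  then show ?thesis
    unfolding algebra_over_def
    by (auto intro!: ext simp: closed ev' s.scale_right_distrib s.scale_left_distrib)
qed

text \<open>This isolates the features of \<open>big_P\<close> that drive the argument:
  \<open>u0\<close> stands for the generator of P(0) and \<open>\<epsilon>\<close> for the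
  coordinate on it. \<open>eps_at\<close> makes the maps \<open>T u\<close> endomorphisms, and
  \<open>spanned\<close> controls the composite of \<open>\<epsilon>\<close> with an arbitrary
  endomorphism.\<close>

locale peak_representation = s: vector_space s
  for s :: "'k::field \<Rightarrow> 'v::ab_group_add \<Rightarrow> 'v" and r :: "('p \<times> 'p) set" and \<theta>
    and V :: "('p, 'v) rep" +
  fixes u0 :: 'v and \<epsilon> :: "'v \<Rightarrow> 'k"
  assumes rep: "representation s r \<theta> V"
    and u0: "u0 \<in> rep_space V" and eps_u0 [simp]: "\<epsilon> u0 = 1"
    and eps_add [simp]: "\<epsilon> (u + v) = \<epsilon> u + \<epsilon> v" and eps_scale [simp]: "\<epsilon> (s c u) = c * \<epsilon> u"
    and eps_at: "\<lbrakk>z \<in> \<theta>; h \<in> rep_at V z; x \<in> z\<rbrakk> \<Longrightarrow> \<epsilon> (h x) = 0"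
    and spanned: "rep_space V \<subseteq> s.span (insert u0 (\<Union>z\<in>\<theta>. \<Union>x\<in>z. V_plus V z x))"
begin

abbreviation A where "A \<equiv> rep_End s \<theta> V"

text \<open>The projection onto the line of \<open>u0\<close> along the kernel of
  \<open>\<epsilon>\<close>, followed by the linear map sending \<open>u0\<close> to
  \<open>u\<close>.\<close>

definition T :: "'v \<Rightarrow> 'v \<Rightarrow> 'v" where
  "T u = (\<lambda>v\<in>rep_space V. s (\<epsilon> v) u)"

lemma subspace: "s.subspace (rep_space V)"
  using rep by (simp add: representation_def)

lemmas closed [simp] = s.subspace_0[OF subspace] s.subspace_add[OF subspace]
  s.subspace_scale[OF subspace] u0

lemma rep_at_value: "\<lbrakk>z \<in> \<theta>; h \<in> rep_at V z; x \<in> z\<rbrakk> \<Longrightarrow> h x \<in> rep_space V"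
  using rep unfolding representation_def fun_space_def by blast

lemma eps_zero [simp]: "\<epsilon> 0 = 0"
  using eps_scale[of 0 u0] by simp

lemma u0_nonzero [simp]: "u0 \<noteq> 0"
  using eps_u0 eps_zero by fastforce

lemma T_apply: "v \<in> rep_space V \<Longrightarrow> T u v = s (\<epsilon> v) u"
  by (simp add: T_def)

lemma T_u0 [simp]: "T u u0 = u"
  by (simp add: T_apply)

lemma T_inject [simp]: "T u = T v \<longleftrightarrow> u = v"
  by (metis T_u0)

lemma algebra: "algebra_over (rep_End_scale s V) A"
  by (rule algebra_over_rep_End[OF rep])

sublocale A: plain_ring A
  using algebra by (simp add: plain_ring_def algebra_over_def)

lemma carrierD:
  assumes "a \<in> carrier A"
  shows "a \<in> extensional (rep_space V)" "v \<in> rep_space V \<Longrightarrow> a v \<in> rep_space V"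
    "\<lbrakk>u \<in> rep_space V; v \<in> rep_space V\<rbrakk> \<Longrightarrow> a (u + v) = a u + a v"
    "v \<in> rep_space V \<Longrightarrow> a (s c v) = s c (a v)"
    "\<lbrakk>z \<in> \<theta>; h \<in> rep_at V z\<rbrakk> \<Longrightarrow> fun_map z a h \<in> rep_at V z"
  using assms unfolding rep_End_def rep_hom_def by (auto simp: PiE_iff image_subset_iff)

lemma endo_eqI:
  assumes "a \<in> carrier A" "b \<in> carrier A" "\<And>v. v \<in> rep_space V \<Longrightarrow> a v = b v"
  shows "a = b"
  using extensionalityI[OF carrierD(1)[OF assms(1)] carrierD(1)[OF assms(2)] assms(3)] .

lemma mult_apply: "v \<in> rep_space V \<Longrightarrow> (a \<otimes>\<^bsub>A\<^esub> b) v = a (b v)"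
  by (simp add: rep_End_def compose_def)

text \<open>By \<open>eps_at\<close>, \<open>T u\<close> kills all values on \<open>z\<close> of
  members of V_z, so it sends V_z to zero.\<close>

lemma T_carrier [simp]:
  assumes "u \<in> rep_space V"
  shows "T u \<in> carrier A"
proof -
  have "fun_map z (T u) h \<in> rep_at V z" if "z \<in> \<theta>" "h \<in> rep_at V z" for z h
  proof -
    have "fun_map z (T u) h = 0"
      using eps_at[OF that] rep_at_value[OF that] by (auto simp: fun_map_def T_apply fun_eq_iff)
    moreover have "module.subspace (fun_scale s) (rep_at V z)"
      using rep that unfolding representation_def by blast
    ultimately show ?thesis
      using vector_space_subspaceD(1) vector_space_fun_scale s.vector_space_axioms by metis
  qed
  then show ?thesis
    using assms
    by (auto simp: rep_End_def rep_hom_def T_def s.scale_left_distrib )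
qed

lemma T_add: "T u \<oplus>\<^bsub>A\<^esub> T v = T (u + v)"
  by (simp add: rep_End_def T_def s.scale_right_distrib cong: restrict_cong)

lemma T_zero: "\<zero>\<^bsub>A\<^esub> = T 0"
  by (simp add: rep_End_def T_def)

lemma mult_T: "\<lbrakk>a \<in> carrier A; u \<in> rep_space V\<rbrakk> \<Longrightarrow> a \<otimes>\<^bsub>A\<^esub> T u = T (a u)"
  by (rule endo_eqI) (simp_all add: carrierD mult_apply T_apply)

text \<open>Since \<open>a\<close> maps V_z into itself, both sides vanish on every V_x^+ by
  \<open>eps_at\<close>. They agree at \<open>u0\<close>, where \<open>\<epsilon>\<close> is 1.
  Being linear in \<open>v\<close>, they agree on the span.\<close>

lemma eps_endo:
  assumes a: "a \<in> carrier A" and v: "v \<in> rep_space V"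
  shows "\<epsilon> (a v) = \<epsilon> v * \<epsilon> (a u0)"
proof -
  let ?W = "{v \<in> rep_space V. \<epsilon> (a v) = \<epsilon> v * \<epsilon> (a u0)}"
  have a0: "a 0 = 0" using carrierD(4)[OF a u0, of 0] by simp
  have "s.subspace ?W"
    by (rule s.subspaceI) (auto simp: a0 carrierD(3,4)[OF a] distrib_right)
  moreover have "h x \<in> ?W" if h: "z \<in> \<theta>" "h \<in> rep_at V z" "x \<in> z" for z h x
    using eps_at[OF h] eps_at[OF h(1) carrierD(5)[OF a h(1,2)] h(3)] rep_at_value[OF h] h(3)
    by (simp add: fun_map_def)
  ultimately have "s.span (insert u0 (\<Union>z\<in>\<theta>. \<Union>x\<in>z. V_plus V z x)) \<subseteq> ?W"
    by (intro s.span_minimal) (auto simp: V_plus_def proj_at_def)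
  then show ?thesis using spanned v by blast
qed

text \<open>By \<open>eps_endo\<close> the scalar depends on \<open>a\<close> but not on
  \<open>u\<close>: right multiplication acts on all \<open>T u\<close> through one character of the
  algebra. This is why the simple summands of the socle are all isomorphic.\<close>

lemma T_mult:
  assumes "a \<in> carrier A" and "u \<in> rep_space V"
  shows "T u \<otimes>\<^bsub>A\<^esub> a = T (s (\<epsilon> (a u0)) u)"
proof (rule endo_eqI)
  fix v assume "v \<in> rep_space V"
  then show "(T u \<otimes>\<^bsub>A\<^esub> a) v = T (s (\<epsilon> (a u0)) u) v"
    using assms by (simp add: mult_apply T_apply carrierD(2) eps_endo[of a v])
qed (use assms in simp_all)

section \<open>The simple projective module e0 A and the socle\<close>

abbreviation S where "S \<equiv> principal_rmodule (T u0) A"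

lemma carrier_S: "carrier S = range (\<lambda>c. T (s c u0))"
proof -
  have "T (s c u0) = T u0 \<otimes>\<^bsub>A\<^esub> T (s c u0)" for c by (simp add: T_mult)
  then have "T (s c u0) \<in> carrier S" for c
    unfolding principal_rmodule_def by (auto intro!: image_eqI[of _ _ "T (s c u0)"])
  then show ?thesis by (auto simp: principal_rmodule_def T_mult)
qed

lemma S_simps: "zero S = T 0" "add S = add A" "ract S = mult A"
  by (simp_all add: principal_rmodule_def regular_rmodule_def T_zero)

lemma simple_S: "simple_rmodule A S"
  unfolding simple_rmodule_def
proof (intro conjI allI impI)
  show "right_module A S" by (simp add: A.right_module_principal)
  have "T (s 1 u0) \<noteq> T 0" by simp
  then show "carrier S \<noteq> {\<zero>\<^bsub>S\<^esub>}" unfolding carrier_S S_simps by blast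
next
  fix N assume N: "rsubmodule N A S"
  show "N = {\<zero>\<^bsub>S\<^esub>} \<or> N = carrier S"
  proof (cases "N \<subseteq> {\<zero>\<^bsub>S\<^esub>}")
    case True
    then show ?thesis using N by (auto simp: rsubmodule_def)
  next
    case False
    then obtain c where c: "T (s c u0) \<in> N" "c \<noteq> 0"
      using N by (fastforce simp: rsubmodule_def carrier_S S_simps)
    have "T (s d u0) \<in> N" for d
    proof -
      \<comment> \<open>The character takes the value d/c on the right factor, so the coefficient c
        becomes d.\<close>
      have "T (s c u0) \<otimes>\<^bsub>A\<^esub> T (s (d / c) u0) \<in> N"
        using N c by (simp add: rsubmodule_def S_simps)
      then show ?thesis using c by (simp add: T_mult)
    qed
    then show ?thesis using N by (auto simp: rsubmodule_def carrier_S)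
  qed
qed

lemma projective_S: "projective_rmodule A S"
  by (rule A.projective_principal) (simp_all add: T_mult)

text \<open>If \<open>a v\<close> is nonzero, then \<open>a\<close> times \<open>T v\<close> is
  \<open>T (a v)\<close>, which is nonzero and is fixed by right multiplication with
  \<open>T u0\<close>.\<close>

lemma faithful:
  assumes a: "a \<in> carrier A" "a \<noteq> \<zero>\<^bsub>A\<^esub>"
  shows "\<exists>b\<in>carrier A. a \<otimes>\<^bsub>A\<^esub> b \<otimes>\<^bsub>A\<^esub> T u0 \<noteq> \<zero>\<^bsub>A\<^esub>"
proof -
  obtain v where v: "v \<in> rep_space V" "a v \<noteq> 0"
  proof (rule ccontr)
    assume "\<not> thesis"
    then have "a = T 0"
      using that carrierD(1)[OF a(1)] by (intro extensionalityI) (auto simp: T_def)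
    then show False using a by (simp add: T_zero)
  qed
  then have "a \<otimes>\<^bsub>A\<^esub> T v \<otimes>\<^bsub>A\<^esub> T u0 \<noteq> \<zero>\<^bsub>A\<^esub>"
    using a by (simp add: mult_T T_mult T_zero carrierD(2))
  then show ?thesis using v by (intro bexI[of _ "T v"]) auto
qed

lemma socle_eq: "socle A (regular_rmodule A) = T ` rep_space V"
proof -
  have "\<exists>b\<in>carrier A. T u0 \<otimes>\<^bsub>A\<^esub> a = b \<otimes>\<^bsub>A\<^esub> T u0" if "a \<in> carrier A" for a
    \<comment> \<open>By \<open>T_mult\<close>, e0 a is a scalar multiple of e0, so it lies in A
      e0.\<close>
    using that by (intro bexI[of _ "T (s (\<epsilon> (a u0)) u0)"]) (simp_all add: T_mult)
  then have "socle A (regular_rmodule A) = (\<lambda>b. b \<otimes>\<^bsub>A\<^esub> T u0) ` carrier A"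
    using A.socle_regular[OF simple_S] faithful by simp
  also have "\<dots> = T ` rep_space V"
  proof (intro equalityI subsetI)
    fix x assume "x \<in> T ` rep_space V"
    then obtain u where "u \<in> rep_space V" "x = T u" by blast
    then show "x \<in> (\<lambda>b. b \<otimes>\<^bsub>A\<^esub> T u0) ` carrier A"
      by (intro image_eqI[of _ _ "T u"]) (simp_all add: T_mult)
  qed (auto simp: mult_T carrierD(2))
  finally show ?thesis .
qed

text \<open>A basis \<open>B\<close> of the space splits the socle into lines spanned by the
  \<open>T b\<close>. The algebra acts on each of them by the same character, as it does on e0
  A.\<close>

lemma socle_iso_copower:
  "\<exists>I :: ('v \<Rightarrow> 'v) set.
     rmod_iso A (submod (regular_rmodule A) (socle A (regular_rmodule A))) (copower I S)"
proof -
  obtain B where B: "B \<subseteq> rep_space V" "s.independent B" "rep_space V \<subseteq> s.span B"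
    using s.basis_exists[of "rep_space V"] by metis
  let ?soc = "submod (regular_rmodule A) (T ` rep_space V)" and ?C = "copower (T ` B) S"
  let ?rep = "\<lambda>u. s.representation B u"
  \<comment> \<open>The copies are indexed by the elements \<open>T b\<close>, since
    \<open>right_peak_algebra\<close> takes its index set inside the algebra. Evaluation at
    \<open>u0\<close> recovers u from \<open>T u\<close>, so \<open>F (T u)\<close> lists the
    coordinates of u.\<close>
  define F where "F x = (\<lambda>i\<in>T ` B. T (s (?rep (x u0) (i u0)) u0))" for x
  have F_T: "F (T u) = (\<lambda>i\<in>T ` B. T (s (?rep u (i u0)) u0))" for u
    by (simp add: F_def)
  have span: "u \<in> s.span B" if "u \<in> rep_space V" for u using B that by blast
  have F_hom: "F \<in> rmod_hom A ?soc ?C"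
  proof -
    have "F (T u) \<in> carrier ?C" for u
    proof -
      have "{i \<in> T ` B. F (T u) i \<noteq> \<zero>\<^bsub>S\<^esub>} \<subseteq> T ` {b. ?rep u b \<noteq> 0}"
        by (auto simp: F_T S_simps)
      then have "finite {i \<in> T ` B. F (T u) i \<noteq> \<zero>\<^bsub>S\<^esub>}"
        by (rule finite_subset) (intro finite_imageI s.finite_representation)
      moreover have "F (T u) \<in> T ` B \<rightarrow>\<^sub>E carrier S" by (auto simp: F_T carrier_S)
      ultimately show ?thesis by (simp add: copower_def)
    qed
    moreover have "F (T u \<oplus>\<^bsub>A\<^esub> T v) = F (T u) \<oplus>\<^bsub>?C\<^esub> F (T v)"
      if "u \<in> rep_space V" "v \<in> rep_space V" for u v
      using that B span
      by (auto simp: T_add F_T copower_def S_simps s.representation_add s.scale_left_distrib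
          fun_eq_iff)
    moreover have "F (T u \<otimes>\<^bsub>A\<^esub> a) = F (T u) \<star>\<^bsub>?C\<^esub> a"
      if "u \<in> rep_space V" "a \<in> carrier A" for u a
      using that B span
      by (auto simp: T_mult F_T copower_def S_simps s.representation_scale fun_eq_iff)
    ultimately show ?thesis
      by (auto simp: rmod_hom_def regular_rmodule_def)
  qed
  have "bij_betw F (T ` rep_space V) (carrier ?C)"
    unfolding bij_betw_def
  proof (intro conjI equalityI subsetI inj_onI)
    fix x y assume xy: "x \<in> T ` rep_space V" "y \<in> T ` rep_space V" "F x = F y"
    then obtain u v where uv: "u \<in> rep_space V" "v \<in> rep_space V" "x = T u" "y = T v" by blast
    have "?rep u b = ?rep v b" for b
    proof (cases "b \<in> B")
      case True
      then have "T (s (?rep u b) u0) = T (s (?rep v b) u0)"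
        using fun_cong[OF xy(3), of "T b"] by (simp add: uv F_T)
      then show ?thesis by simp
    next
      case False
      then show ?thesis using s.representation_ne_zero by metis
    qed
    then have eq: "?rep u = ?rep v" by (rule ext)
    have "u = v"
      by (rule trans[OF s.sum_nonzero_representation_eq[OF B(2) span[OF uv(1)], symmetric]])
        (simp only: eq s.sum_nonzero_representation_eq[OF B(2) span[OF uv(2)]])
    then show "x = y" using uv by simp
  next
    fix f assume f: "f \<in> carrier ?C"
    \<comment> \<open>An element of e0 A is \<open>T (s c u0)\<close>, and c is read off by
      evaluating at \<open>u0\<close> and applying \<open>\<epsilon>\<close>. The value 0 off
      \<open>B\<close> matches the coordinate function \<open>s.representation B\<close>, which
      vanishes there.\<close>
    let ?c = "\<lambda>b. if b \<in> B then \<epsilon> (f (T b) u0) else 0"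
    let ?u = "\<Sum>b | ?c b \<noteq> 0. s (?c b) b"
    have fT: "f (T b) = T (s (?c b) u0)" if "b \<in> B" for b
    proof -
      have "f (T b) \<in> carrier S" using f that by (auto simp: copower_def)
      then show ?thesis using that by (auto simp: carrier_S)
    qed
    \<comment> \<open>Evaluation at \<open>u0\<close> recovers b from \<open>T b\<close>, so the
      finite support of \<open>f\<close> bounds that of \<open>?c\<close>.\<close>
    have "{b. ?c b \<noteq> 0} \<subseteq> (\<lambda>i. i u0) ` {i \<in> T ` B. f i \<noteq> \<zero>\<^bsub>S\<^esub>}"
    proof
      fix b assume b: "b \<in> {b. ?c b \<noteq> 0}"
      then have "f (T b) \<noteq> \<zero>\<^bsub>S\<^esub>"
        by (auto simp: S_simps split: if_splits)
      then show "b \<in> (\<lambda>i. i u0) ` {i \<in> T ` B. f i \<noteq> \<zero>\<^bsub>S\<^esub>}"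
        using b by (intro image_eqI[of _ _ "T b"]) (auto split: if_splits)
    qed
    then have fin: "finite {b. ?c b \<noteq> 0}"
      by (rule finite_subset) (use f in \<open>auto simp: copower_def\<close>)
    have uV: "?u \<in> rep_space V"
      using B by (intro s.subspace_sum[OF subspace]) (auto split: if_splits)
    have "?rep ?u = ?c"
      by (rule s.representation_eqI[OF B(2) span[OF uV] _ fin]) (auto split: if_splits)
    then have val: "F (T ?u) i = f i" if "i \<in> T ` B" for i
      using that fT by (auto simp: F_T)
    have "f \<in> extensional (T ` B)" using f by (simp add: copower_def PiE_iff)
    then have eq: "F (T ?u) = f"
      by (intro extensionalityI[OF _ _ val]) (simp_all only: F_T restrict_extensional)
    have "F (T ?u) \<in> F ` T ` rep_space V" by (intro imageI uV)
    then show "f \<in> F ` T ` rep_space V" by (simp only: eq)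
  qed (use F_hom in \<open>auto simp: rmod_hom_def\<close>)
  then have "rmod_iso A ?soc ?C"
    using F_hom by (auto simp: rmod_iso_def)
  then show ?thesis unfolding socle_eq by blast
qed

lemma right_peak: "right_peak_algebra (rep_End_scale s V) A"
proof -
  obtain I :: "('v \<Rightarrow> 'v) set" where
    "rmod_iso A (submod (regular_rmodule A) (socle A (regular_rmodule A))) (copower I S)"
    using socle_iso_copower by (rule exE)
  then show ?thesis
    unfolding right_peak_algebra_def
    by (intro conjI algebra exI[of _ S] exI[of _ I] simple_S projective_S)
qed

lemma simple_projective_iso_S:
  "\<lbrakk>simple_rmodule A M; projective_rmodule A M\<rbrakk> \<Longrightarrow> rmod_iso A M S"
  by (rule A.simple_projective_iso_principal[OF simple_S T_carrier[OF u0] faithful])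

end

section \<open>Verification for the direct sum of all P(z) and P(0)\<close>

section \<open>The representation \<open>big_P\<close>\<close>

text \<open>The first generator of P(z)_z takes the value \<open>basis_vec x\<close> at
  \<open>x\<close>. Placed in summand \<open>z\<close>, with zero in all other summands, it is a
  member of V_z.\<close>

lemma basis_vec_mem_V_plus:
  fixes r :: "('p \<times> 'p) set" and \<theta> :: "'p set set"
  assumes \<theta>: "\<And>w. w \<in> \<theta> \<Longrightarrow> representation (fun_scale (*)) r \<theta> (rep_P r w :: ('p, 'p \<Rightarrow> 'k::field) rep)"
    and z: "z \<in> \<theta>" and x: "x \<in> z"
  shows "(inj_at z (basis_vec x), 0) \<in> V_plus (big_P r \<theta> :: ('p, ('p, 'k) big_space) rep) z x"
proof -
  interpret f: vector_space "fun_scale (fun_scale (*)) :: 'k \<Rightarrow> ('p \<Rightarrow> 'p \<Rightarrow> 'k) \<Rightarrow> 'p \<Rightarrow> 'p \<Rightarrow> 'k"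
    by (intro vector_space_fun_scale vector_space_times)
  let ?g = "\<lambda>x. if x \<in> z then basis_vec x else 0 :: 'p \<Rightarrow> 'k"
  have g: "?g \<in> rep_at (rep_P r z) z"
    by (simp add: rep_P_def f.span_base)
  have "(\<lambda>x. inj_at z (?g x) w) \<in> rep_at (rep_P r w) z" if w: "w \<in> \<theta>" for w
  proof (cases "w = z")
    case True
    then show ?thesis using g by (simp add: inj_at_def)
  next
    case False
    have "f.subspace (rep_at (rep_P r w) z)"
      using \<theta>[OF w] z unfolding representation_def by blast
    then show ?thesis using f.subspace_0 False by (simp add: inj_at_def zero_fun_def)
  qed
  then have "(\<lambda>x. (inj_at z (?g x), 0)) \<in> rep_at (big_P r \<theta> :: ('p, ('p, 'k) big_space) rep) z"
    using z by (auto simp: rep_at_big_P rep_Sum_def) (auto simp: inj_at_def)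
  then show ?thesis
    unfolding V_plus_def by (rule rev_image_eqI) (simp add: proj_at_def x)
qed

text \<open>Each P(z)_0 is spanned by basis vectors, which lie in the spaces V_x^+ by
  \<open>basis_vec_mem_V_plus\<close>; the summand P(0) is the line of
  \<open>(0, 1)\<close>.\<close>

lemma span_big_P:
  fixes r :: "('p \<times> 'p) set" and \<theta> :: "'p set set"
  assumes fin: "finite \<theta>"
    and \<theta>: "\<And>w. w \<in> \<theta> \<Longrightarrow> representation (fun_scale (*)) r \<theta> (rep_P r w :: ('p, 'p \<Rightarrow> 'k::field) rep)"
  defines "V \<equiv> big_P r \<theta> :: ('p, ('p, 'k) big_space) rep"
  shows "rep_space V \<subseteq> module.span big_scale (insert (0, 1) (\<Union>z\<in>\<theta>. \<Union>x\<in>z. V_plus V z x))"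
proof
  interpret v: vector_space "fun_scale (*) :: 'k \<Rightarrow> ('p \<Rightarrow> 'k) \<Rightarrow> 'p \<Rightarrow> 'k"
    by (intro vector_space_fun_scale vector_space_times)
  interpret p: vector_space "big_scale :: 'k \<Rightarrow> ('p, 'k) big_space \<Rightarrow> ('p, 'k) big_space"
    unfolding big_scale_def
    by (intro vector_space_prod_scale vector_space_fun_scale vector_space_times)
  let ?G = "insert (0, 1) (\<Union>z\<in>\<theta>. \<Union>x\<in>z. V_plus V z x)"
  have single: "(inj_at z g, 0) \<in> p.span ?G" if z: "z \<in> \<theta>" and g: "g \<in> v.span (basis_vec ` z)" for z g
    using g
  proof (induction rule: v.span_induct_alt)
    case base
    have "(inj_at z 0, 0) = (0 :: ('p, 'k) big_space)"
      by (auto simp: inj_at_def zero_prod_def fun_eq_iff)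
    then show ?case using p.span_zero by (simp only:)
  next
    case (step c b g)
    then obtain x where x: "x \<in> z" "b = basis_vec x" by blast
    then have "(inj_at z b, 0) \<in> ?G"
      using basis_vec_mem_V_plus[OF \<theta> z] z unfolding V_def by blast
    then have "big_scale c (inj_at z b, 0) + (inj_at z g, 0) \<in> p.span ?G"
      using step.IH by (rule p.span_add[OF p.span_scale[OF p.span_base]])
    moreover have "big_scale c (inj_at z b, 0) + (inj_at z g, 0) = (inj_at z (fun_scale (*) c b + g), 0)"
      by (auto simp: big_scale_def prod_scale_def fun_scale_def inj_at_def fun_eq_iff)
    ultimately show ?case by (simp only:)
  qed
  fix v :: "('p, 'k) big_space" assume v: "v \<in> rep_space V"
  have fz: "fst v z \<in> v.span (basis_vec ` z)" if "z \<in> \<theta>" for z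
    using v that by (auto simp: V_def big_P_def rep_plus_def rep_Sum_def rep_P_def)
  have f0: "fst v z = 0" if "z \<notin> \<theta>" for z
    using v that by (auto simp: V_def big_P_def rep_plus_def rep_Sum_def)
  have sum_apply: "fst (\<Sum>z\<in>K. (inj_at z (fst v z), 0 :: 'k)) y = (if y \<in> K then fst v y else 0)"
    "snd (\<Sum>z\<in>K. (inj_at z (fst v z), 0 :: 'k)) = 0" if "finite K" for K y
    using that by (induction K) (auto simp: inj_at_def)
  have "v = (\<Sum>z\<in>\<theta>. (inj_at z (fst v z), 0)) + big_scale (snd v) (0, 1)"
    using f0 by (simp add: prod_eq_iff fun_eq_iff[where f = "fst v"] sum_apply[OF fin]
        big_scale_def prod_scale_def fun_scale_def zero_fun_def[symmetric])
  also have "\<dots> \<in> p.span ?G"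
    by (intro p.span_add p.span_sum p.span_scale single fz) (auto intro: p.span_base)
  finally show "v \<in> p.span ?G" .
qed

text \<open>The functional \<open>snd\<close> is the coordinate on P(0); it vanishes on values of
  members of V_z because P(0)_z = 0.\<close>

lemma peak_representation_big_P:
  assumes "finite P" and "poset_with_involution P r \<theta>"
  shows "peak_representation (big_scale :: 'k::field \<Rightarrow> _) r \<theta> (big_P r \<theta>) (0, 1) snd"
proof -
  let ?V = "big_P r \<theta> :: ('a, ('a, 'k) big_space) rep"
  have \<theta>: "finite \<theta>" "\<And>w. w \<in> \<theta> \<Longrightarrow> representation (fun_scale (*)) r \<theta> (rep_P r w :: ('a, 'a \<Rightarrow> 'k) rep)"
    using assms by (auto simp: poset_with_involution_def equiv_def intro: finite_quotient representation_P)
  have rep: "representation big_scale r \<theta> ?V" by (rule representation_big_P[OF assms])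
  interpret p: vector_space "big_scale :: 'k \<Rightarrow> ('a, 'k) big_space \<Rightarrow> _"
    using rep by (simp add: representation_def)
  have "0 \<in> rep_space ?V"
    using rep p.subspace_0 by (simp add: representation_def)
  then have "(0, 1) \<in> rep_space ?V"
    by (simp add: big_P_def rep_plus_def rep_P0_def zero_prod_def)
  then show ?thesis
    using rep span_big_P[OF \<theta>]
    by unfold_locales (auto simp: rep_at_big_P big_scale_def prod_scale_def)
qed

theorem proposition9:
  fixes P :: "'p set" and r :: "('p \<times> 'p) set" and \<theta> :: "'p set set"
    and A :: "(('p, 'k::field) big_space \<Rightarrow> ('p, 'k) big_space) ring"
    and e\<^sub>0 :: "('p, 'k) big_space \<Rightarrow> ('p, 'k) big_space"
  assumes "finite P" and "poset_with_involution P r \<theta>"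
    and "A = rep_End big_scale \<theta> (big_P r \<theta>)"
    and "e\<^sub>0 = big_e0 r \<theta>"
  shows "right_peak_algebra (rep_End_scale big_scale (big_P r \<theta>)) A \<and>
    simple_rmodule A (principal_rmodule e\<^sub>0 A) \<and>
    projective_rmodule A (principal_rmodule e\<^sub>0 A) \<and>
    (\<forall>M :: (('p, 'k) big_space \<Rightarrow> ('p, 'k) big_space, 'm) rmodule.
       simple_rmodule A M \<and> projective_rmodule A M \<longrightarrow> rmod_iso A M (principal_rmodule e\<^sub>0 A))"
proof -
  interpret peak_representation big_scale r \<theta> "big_P r \<theta> :: ('p, ('p, 'k) big_space) rep" "(0, 1)" snd
    by (rule peak_representation_big_P[OF assms(1,2)])
  \<comment> \<open>Scaling \<open>(0, 1)\<close> by \<open>snd v\<close> gives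
    \<open>(0, snd v)\<close>, so e0 is one of the maps \<open>T u\<close>.\<close>
  have e0: "e\<^sub>0 = T (0, 1)"
    unfolding assms(4) big_e0_def T_def
    by (simp add: big_scale_def prod_scale_def fun_scale_def zero_fun_def)
  show ?thesis
    unfolding assms(3) e0
    by (intro conjI allI impI right_peak simple_S projective_S simple_projective_iso_S) simp_all
qed

end
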